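(* Let $T>0$, let $\mathbf L\subset\mathbb Z$, and let $\Lambda=\{\lambda_m:m\in\mathbf L\}\subset\mathbb C^+$ be a family of distinct points. Let $\varkappa=1/2$, or $\varkappa=1/(2\alpha)$ for some $\alpha\in(1,3/2)$. Suppose there exist a function $\nu:[0,\infty)\to[0,\infty)$ and constants $R_0,C_0,C_1>0$ such that $$\#\{\lambda_n\in\Lambda\setminus\{\lambda_k\}:|\lambda_n-\lambda_k|<r\}\le\nu(r)\quad\text{for all }k\in\mathbf L,\ r\ge 0,$$ $$\nu(r)=0\ \text{ for } r<R_0,\qquad C_0r^{\varkappa}\le\nu(r)\le C_1r^{\varkappa}\ \text{ for } r\ge R_0 .$$ Then there exists a family of functions $\{g_{m,j}:m\in\mathbf L,\ j=1,2\}$ in $L^2(0,T)$ satisfying, for all $m,n\in\mathbf L$, $$\langle g_{m,1},te^{i\lambda_nt}\rangle=0,\quad \langle g_{m,1},e^{i\lambda_nt}\rangle=\delta_{m,n},\quad \langle g_{m,2},te^{i\lambda_nt}\rangle=\delta_{m,n},\quad \langle g_{m,2},e^{i\lambda_nt}\rangle=0.$$ Furthermore, there exist positive constants $C_2,C_3$ depending only on $R_0,T,C_0,C_1$ such that for $j=1,2$ and all $m\in\mathbf L$, $$\|g_{m,j}\|_{L^2(0,T)}\le C_2e^{C_3(\Im\lambda_m)^{\varkappa}}.$$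
   Context: $\mathbb C^+$ is the open upper half plane; $\langle f,g\rangle=\int_0^Tf(t)\overline{g(t)}\,dt$; $\delta_{m,n}$ is the Kronecker delta; $\Im$ denotes the imaginary part. The exponent $\varkappa$ is regarded as given. *)

theory Defs
  imports "HOL-Analysis.Analysis"
begin

text \<open>
  Elements of \<open>L\<^sup>2(0,T)\<close> are represented by functions on \<open>\<real>\<close>, of which only the
  restriction to \<open>(0,T)\<close> matters.
\<close>

definition L2_fun :: "real \<Rightarrow> (real \<Rightarrow> complex) \<Rightarrow> bool" where
  "L2_fun T f \<longleftrightarrow>
     f \<in> borel_measurable (lebesgue_on {0<..<T}) \<and>
     integrable (lebesgue_on {0<..<T}) (\<lambda>t. (norm (f t))\<^sup>2)"

definition L2_inner :: "real \<Rightarrow> (real \<Rightarrow> complex) \<Rightarrow> (real \<Rightarrow> complex) \<Rightarrow> complex" where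
  "L2_inner T f g = (LINT t|lebesgue_on {0<..<T}. f t * cnj (g t))"

definition L2_norm :: "real \<Rightarrow> (real \<Rightarrow> complex) \<Rightarrow> real" where
  "L2_norm T f = sqrt (LINT t|lebesgue_on {0<..<T}. (norm (f t))\<^sup>2)"

text \<open>
  The \<open>finite\<close> conjunct below belongs to the inequality: an infinite set has
  \<open>card\<close> zero, whereas the count being bounded by a real number entails finiteness.
\<close>

definition counting_bound :: "complex set \<Rightarrow> (real \<Rightarrow> real) \<Rightarrow> bool" where
  "counting_bound \<Lambda> \<nu> \<longleftrightarrow>
     (\<forall>w\<in>\<Lambda>. \<forall>r\<ge>0.
        finite {z \<in> \<Lambda> - {w}. norm (z - w) < r} \<and>
        real (card {z \<in> \<Lambda> - {w}. norm (z - w) < r}) \<le> \<nu> r)"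

end

theory Submission
  imports Defs "HOL-Complex_Analysis.Complex_Analysis"
begin

text \<open>
  Write \<open>F z = \<integral> h t * exp (\<i> * z * t) dt\<close> over \<open>[0, T]\<close> with \<open>h = cnj g\<close>. Biorthogonality
  prescribes \<open>F\<close> and \<open>F'\<close> at the points \<open>\<lambda>\<^sub>n\<close>. We take \<open>F\<close> to be the square \<open>Q\<close> of a canonical product,
  centred at \<open>\<lambda>\<^sub>m\<close>, times a factor of degree at most one, times the transform \<open>M\<close> of a Gevrey bump
  \<open>exp (- a * (t powr - \<rho> + (T - t) powr - \<rho>))\<close> with \<open>\<rho> = \<kappa> / (1 - \<kappa>)\<close>, modulated to sit at \<open>Re \<lambda>\<^sub>m\<close>.
  The counting bound and \<open>\<kappa> \<le> 1/2\<close> give \<open>norm (Q v) \<le> exp (A * norm v powr \<kappa>)\<close>. No Paley-Wiener theorem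
  is needed: multiplication of \<open>M\<close> by an entire function of this growth is a differential operator
  of infinite order on the time side, and its series converges on the bump once \<open>a\<close> is large. The
  factor \<open>exp (C * Im \<lambda>\<^sub>m powr \<kappa>)\<close> comes from recentring \<open>Q\<close> and from dividing by \<open>M (\<i> * Im \<lambda>\<^sub>m)\<close>.
\<close>

subsection \<open>Canonical products\<close>

text \<open>Euler's sine product at \<open>\<i> * x\<close> shows that these products increase to
  \<open>sinh (pi * x) / (pi * x)\<close>, which is at most \<open>exp (pi * x)\<close>.\<close>

lemma prod_one_plus_square_le_exp:
  fixes x :: real
  assumes "x \<ge> 0"
  shows "(\<Prod>k=1..n. 1 + (x / real k)\<^sup>2) \<le> exp (pi * x)"
proof (cases "x = 0")
  case False
  with assms have x: "x > 0" by simp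
  define P where "P = (\<lambda>n. \<Prod>k=1..n. 1 + (x / real k)\<^sup>2)"
  have sq: "1 - (\<i> * of_real x)\<^sup>2 / (of_nat k)\<^sup>2 = complex_of_real (1 + (x / real k)\<^sup>2)" for k
    by (simp add: power_mult_distrib power_divide)
  have "(\<lambda>n. of_real pi * (\<i> * of_real x) * (\<Prod>k=1..n. 1 - (\<i> * of_real x)\<^sup>2 / (of_nat k)\<^sup>2))
          \<longlonglongrightarrow> sin (of_real pi * (\<i> * complex_of_real x))"
    by (rule sin_product_formula_complex)
  then have lim: "(\<lambda>n. norm (of_real pi * (\<i> * of_real x) * complex_of_real (P n)))
      \<longlonglongrightarrow> norm (sin (of_real pi * (\<i> * complex_of_real x)))"
    unfolding sq P_def of_real_prod by (rule tendsto_norm)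
  have Ppos: "P n \<ge> 0" for n by (auto simp: P_def intro!: prod_nonneg)
  have "norm (of_real pi * (\<i> * of_real x) * complex_of_real (P n)) = pi * x * P n" for n
    using x Ppos by (simp add: norm_mult)
  moreover have "norm (sin (of_real pi * (\<i> * complex_of_real x))) = sinh (pi * x)"
  proof -
    have "sin (of_real pi * (\<i> * complex_of_real x)) = sin (\<i> * of_real (pi * x))"
      by (simp add: mult_ac)
    also have "\<dots> = \<i> * of_real (sinh (pi * x))"
      by (simp add: sin_exp_eq sinh_def exp_of_real[symmetric] field_simps scaleR_conv_of_real)
    finally show ?thesis using x by (simp add: norm_mult)
  qed
  ultimately have lim': "(\<lambda>n. pi * x * P n) \<longlonglongrightarrow> sinh (pi * x)" using lim by simp
  have "mono P"
    unfolding P_def by (rule monoI) (intro prod_mono2, auto)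
  then have "incseq (\<lambda>n. pi * x * P n)"
    using x by (auto simp: incseq_def intro!: mult_left_mono dest: monoD)
  then have "pi * x * P n \<le> sinh (pi * x)" using lim' by (rule incseq_le)
  also have "sinh (pi * x) \<le> pi * x * exp (pi * x)"
  proof -
    \<comment> \<open>With u = pi * x, multiplying 1 - 2u \<le> e^(-2u) by e^u gives e^u - e^(-u)
      \<le> 2u e^u, which is sinh u \<le> u e^u.\<close>
    have "1 - 2 * (pi * x) \<le> exp (- 2 * (pi * x))"
      using exp_ge_add_one_self[of "- 2 * (pi * x)"] by simp
    then have "exp (pi * x) * (1 - 2 * (pi * x)) \<le> exp (pi * x) * exp (- 2 * (pi * x))"
      by simp
    also have "\<dots> = exp (- (pi * x))" by (simp flip: exp_add)
    finally show ?thesis by (simp add: sinh_def field_simps scaleR_conv_of_real)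
  qed
  finally show ?thesis using x by (simp add: P_def)
qed simp

text \<open>The summands 1 and x^p are compared with 1 and x times (1 + x)^(p - 1), which add up to
  the right side. This moves an exponent from inside the factors of a product to the
  outside.\<close>

lemma one_plus_powr_le:
  fixes x p :: real
  assumes "x \<ge> 0" "p \<ge> 1"
  shows "1 + x powr p \<le> (1 + x) powr p"
proof (cases "x = 0")
  case False
  with assms have x: "x > 0" by simp
  have "x powr p = x * x powr (p - 1)" using x by (simp add: powr_diff)
  also have "\<dots> \<le> x * (1 + x) powr (p - 1)"
    using x assms by (intro mult_left_mono powr_mono2) auto
  finally have 1: "x powr p \<le> x * (1 + x) powr (p - 1)" .
  have 2: "1 \<le> (1 + x) powr (p - 1)" using x assms by (simp add: ge_one_powr_ge_zero)
  have "(1 + x) powr p = (1 + x) * (1 + x) powr (p - 1)" using x by (simp add: powr_diff)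
  then show ?thesis using 1 2 by (simp add: algebra_simps)
qed (use assms in simp)

text \<open>Sorting the weights increasingly, the \<open>j\<close>-th one is at least \<open>(j / C) powr (1 / \<kappa>)\<close>;
  the induction removes the largest weight.\<close>
lemma prod_le_prod_sorted:
  fixes w :: "'a \<Rightarrow> real"
  assumes "finite F" and \<kappa>: "\<kappa> > 0" and C: "C > 0" and r: "r \<ge> 0"
    and "\<And>i. i \<in> F \<Longrightarrow> w i > 0 \<and> real (card {j \<in> F. w j \<le> w i}) \<le> C * w i powr \<kappa>"
  shows "(\<Prod>i\<in>F. 1 + r / w i) \<le> (\<Prod>j=1..card F. 1 + (C * r powr \<kappa> / real j) powr (1 / \<kappa>))"
  using assms(1,5)
proof (induction "card F" arbitrary: F)
  case 0
  then show ?case by simp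
next
  case (Suc n)
  then have "F \<noteq> {}" by auto
  then have "Max (w ` F) \<in> w ` F" using Suc by (intro Max_in) auto
  then obtain i where i: "i \<in> F" "w i = Max (w ` F)" by auto
  have max: "w j \<le> w i" if "j \<in> F" for j using that i Suc by simp
  \<comment> \<open>At the largest weight the hypothesis counts all of \<open>F\<close>, so the
    factor of \<open>i\<close> is dominated by the one with \<open>j = card F\<close>.\<close>
  have "{j \<in> F. w j \<le> w i} = F" using max by auto
  then have w: "w i > 0" "real (card F) \<le> C * w i powr \<kappa>" using Suc.prems(2)[OF i(1)] by auto
  have cF: "card F = Suc n" using Suc by simp
  have "r / w i = ((r / w i) powr \<kappa>) powr (1 / \<kappa>)" using r w \<kappa> by (simp add: powr_powr)
  also have "\<dots> = (r powr \<kappa> / w i powr \<kappa>) powr (1 / \<kappa>)" using r w by (simp add: powr_divide)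
  also have "\<dots> \<le> (C * r powr \<kappa> / real (card F)) powr (1 / \<kappa>)"
  proof (rule powr_mono2)
    have "r powr \<kappa> * real (card F) \<le> r powr \<kappa> * (C * w i powr \<kappa>)"
      using w by (intro mult_left_mono) auto
    then show "r powr \<kappa> / w i powr \<kappa> \<le> C * r powr \<kappa> / real (card F)"
      using w cF by (simp add: field_simps)
  qed (use \<kappa> in auto)
  finally have *: "1 + r / w i \<le> 1 + (C * r powr \<kappa> / real (card F)) powr (1 / \<kappa>)" by simp
  have IH: "(\<Prod>i\<in>F - {i}. 1 + r / w i)
      \<le> (\<Prod>j=1..card (F - {i}). 1 + (C * r powr \<kappa> / real j) powr (1 / \<kappa>))"
  proof (rule Suc.hyps(1))
    show "n = card (F - {i})" using i cF by simp
    show "finite (F - {i})" using Suc by simp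
    fix k assume k: "k \<in> F - {i}"
    have "card {j \<in> F - {i}. w j \<le> w k} \<le> card {j \<in> F. w j \<le> w k}"
      using Suc by (intro card_mono) auto
    then show "w k > 0 \<and> real (card {j \<in> F - {i}. w j \<le> w k}) \<le> C * w k powr \<kappa>"
      using Suc.prems(2)[of k] k by auto
  qed
  have "(\<Prod>i\<in>F. 1 + r / w i) = (\<Prod>i\<in>F - {i}. 1 + r / w i) * (1 + r / w i)"
    using i Suc.prems(1) by (simp add: prod.remove mult.commute)
  also have "\<dots> \<le> (\<Prod>j=1..card (F - {i}). 1 + (C * r powr \<kappa> / real j) powr (1 / \<kappa>)) *
      (1 + (C * r powr \<kappa> / real (card F)) powr (1 / \<kappa>))"
    using IH * r w by (intro mult_mono prod_nonneg) (auto intro!: add_nonneg_nonneg)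
  also have "\<dots> = (\<Prod>j=1..card F. 1 + (C * r powr \<kappa> / real j) powr (1 / \<kappa>))"
    using cF i Suc.prems(1) by simp
  finally show ?case .
qed

text \<open>With N = C r^\<kappa>, each sorted factor 1 + (N/j)^(1/\<kappa>) is at most (1 +
  (N/j)^2)^(1/(2\<kappa>)), because \<kappa> \<le> 1/2 makes the outer exponent at least 1. The
  product of the squares is then the sine product, bounded by exp(pi N).\<close>

lemma prod_le_exp_of_counting:
  fixes w :: "'a \<Rightarrow> real"
  assumes "finite F" and \<kappa>: "0 < \<kappa>" "\<kappa> \<le> 1/2" and C: "C > 0" and r: "r \<ge> 0"
    and w: "\<And>i. i \<in> F \<Longrightarrow> w i > 0 \<and> real (card {j \<in> F. w j \<le> w i}) \<le> C * w i powr \<kappa>"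
  shows "(\<Prod>i\<in>F. 1 + r / w i) \<le> exp (pi * C / (2 * \<kappa>) * r powr \<kappa>)"
proof -
  define N where "N = C * r powr \<kappa>"
  have N: "N \<ge> 0" using C by (simp add: N_def)
  have "(\<Prod>i\<in>F. 1 + r / w i) \<le> (\<Prod>j=1..card F. 1 + (N / real j) powr (1 / \<kappa>))"
    unfolding N_def by (intro prod_le_prod_sorted assms) auto
  also have "\<dots> \<le> (\<Prod>j=1..card F. (1 + (N / real j)\<^sup>2) powr (1 / (2 * \<kappa>)))"
  proof (intro prod_mono conjI)
    fix j assume "j \<in> {1..card F}"
    have "(N / real j) powr (1 / \<kappa>) = ((N / real j) powr 2) powr (1 / (2 * \<kappa>))"
      by (simp add: powr_powr)
    also have "(N / real j) powr 2 = (N / real j)\<^sup>2" using N by simp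
    finally show "1 + (N / real j) powr (1 / \<kappa>) \<le> (1 + (N / real j)\<^sup>2) powr (1 / (2 * \<kappa>))"
      using one_plus_powr_le[of "(N / real j)\<^sup>2" "1 / (2 * \<kappa>)"] \<kappa> by simp
  qed (auto intro: add_nonneg_nonneg)
  also have "\<dots> = (\<Prod>j=1..card F. 1 + (N / real j)\<^sup>2) powr (1 / (2 * \<kappa>))"
    by (simp add: prod_powr_distrib)
  also have "\<dots> \<le> exp (pi * N) powr (1 / (2 * \<kappa>))"
    using prod_one_plus_square_le_exp[OF N] \<kappa> by (intro powr_mono2 prod_nonneg) auto
  also have "\<dots> = exp (pi * C / (2 * \<kappa>) * r powr \<kappa>)"
    by (simp add: exp_powr_real N_def)
  finally show ?thesis .
qed

text \<open>\<open>E\<close> is the infinite product of \<open>1 - z * b j\<close>. The hypothesis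
  at \<open>r = 1\<close> makes \<open>norm (b j)\<close> summable, hence the product converges
  locally uniformly; for general \<open>r\<close> it is the growth bound. Entries
  \<open>b j = 0\<close> contribute the factor 1, so finite zero sets and gaps in an enumeration are
  covered.\<close>

lemma entire_product_exists:
  fixes b :: "nat \<Rightarrow> complex"
  assumes bound: "\<And>n r. r \<ge> 0 \<Longrightarrow> (\<Prod>j<n. 1 + r * norm (b j)) \<le> G r"
  obtains E where "E holomorphic_on UNIV" "E 0 = 1" "\<And>z. norm (E z) \<le> G (norm z)"
    "\<And>j. b j \<noteq> 0 \<Longrightarrow> E (1 / b j) = 0"
proof -
  have "(\<Sum>j<n. norm (b j)) \<le> G 1" for n
  proof -
    have "(\<Sum>j<n. norm (b j)) \<le> (\<Prod>j<n. 1 + norm (b j))"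
      using sum_le_prod[of "{..<n}" "\<lambda>j. norm (b j)"] by simp
    also have "\<dots> \<le> G 1" using bound[of 1 n] by simp
    finally show ?thesis .
  qed
  then have summ: "summable (\<lambda>j. norm (b j))"
    by (intro summableI_nonneg_bounded) auto
  define P where "P = (\<lambda>n z. \<Prod>j<n. 1 + - z * b j)"
  have unif: "uniformly_convergent_on (cball 0 R) P" for R :: real
    unfolding P_def
  proof (rule uniformly_convergent_on_prod)
    show "uniformly_convergent_on (cball 0 R) (\<lambda>N x. \<Sum>n<N. norm (- x * b n))"
    proof (rule Weierstrass_m_test')
      show "summable (\<lambda>n. R * norm (b n))" using summ by (rule summable_mult)
      show "norm (norm (- x * b n)) \<le> R * norm (b n)" if "x \<in> cball 0 R" for n x
        using that by (simp add: norm_mult mult_right_mono)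
    qed
  qed (auto intro!: continuous_intros)
  define E where "E = (\<lambda>z. lim (\<lambda>n. P n z))"
  have lim: "(\<lambda>n. P n z) \<longlonglongrightarrow> E z" for z
    using uniformly_convergent_imp_convergent[OF unif[of "norm z"], of z]
    by (simp add: E_def convergent_LIMSEQ_iff)
  have ulim: "uniform_limit (cball 0 R) P E sequentially" for R
    using unif[of R] by (simp add: uniformly_convergent_uniform_limit_iff E_def)
  show thesis
  proof
    show "E holomorphic_on UNIV"
    proof (rule holomorphic_uniform_sequence)
      show "P n holomorphic_on UNIV" for n
        unfolding P_def by (intro holomorphic_intros)
      show "\<exists>d>0. cball x d \<subseteq> UNIV \<and> uniform_limit (cball x d) P E sequentially" for x
      proof (intro exI[of _ 1] conjI)
        have "cball x 1 \<subseteq> cball 0 (norm x + 1)" by (simp add: cball_subset_cball_iff)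
        then show "uniform_limit (cball x 1) P E sequentially"
          using ulim uniform_limit_on_subset by blast
      qed auto
    qed auto
    show "E 0 = 1" using lim[of 0] by (simp add: P_def LIMSEQ_const_iff)
    show "norm (E z) \<le> G (norm z)" for z
    proof (rule Lim_norm_ubound[OF _ lim])
      show "\<forall>\<^sub>F n in sequentially. norm (P n z) \<le> G (norm z)"
      proof (rule always_eventually, intro allI)
        fix n
        have "norm (P n z) = (\<Prod>j<n. norm (1 + - z * b j))"
          unfolding P_def by (rule prod_norm[symmetric])
        also have "\<dots> \<le> (\<Prod>j<n. 1 + norm z * norm (b j))"
          by (intro prod_mono conjI norm_ge_zero) (metis norm_minus_cancel norm_mult norm_one norm_triangle_ineq)
        also have "\<dots> \<le> G (norm z)" by (rule bound) simp
        finally show "norm (P n z) \<le> G (norm z)" .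
      qed
    qed simp
    show "E (1 / b j) = 0" if "b j \<noteq> 0" for j
    proof -
      have "P n (1 / b j) = 0" if "n > j" for n
        unfolding P_def using that \<open>b j \<noteq> 0\<close> by (intro prod_zero) (auto intro!: bexI[of _ j])
      then have "\<forall>\<^sub>F n in sequentially. P n (1 / b j) = 0"
        by (intro eventually_mono[OF eventually_gt_at_top[of j]])
      then have "(\<lambda>n. P n (1 / b j)) \<longlonglongrightarrow> 0" by (rule tendsto_eventually)
      then show ?thesis using lim LIMSEQ_unique by blast
    qed
  qed
qed

subsection \<open>A Gevrey bump and its derivatives\<close>

text \<open>With \<theta> the argument of z, the two sides are |z|^(-\<rho>) times cos \<theta> and
  cos(\<rho>\<theta>). The cosine decreases in the size of its argument on this range, and \<rho>
  \<le> 1.\<close>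

lemma Re_powr_minus_ge:
  fixes z :: complex
  assumes z: "Re z > 0" and \<rho>: "0 < \<rho>" "\<rho> \<le> 1"
  shows "norm z powr (-\<rho>) * (Re z / norm z) \<le> Re (z powr (- of_real \<rho>))"
proof -
  have z0: "z \<noteq> 0" using z by auto
  define \<theta> where "\<theta> = Im (Ln z)"
  have \<theta>: "\<bar>\<theta>\<bar> < pi / 2" unfolding \<theta>_def using Re_Ln_pos_lt[OF z0] z by blast
  have "Re z = Re (exp (Ln z))" using z0 by simp
  also have "\<dots> = norm z * cos \<theta>" using z0 unfolding Re_exp \<theta>_def by (subst Re_Ln) auto
  finally have c: "Re z / norm z = cos \<theta>" using z0 by simp
  have "cos \<bar>\<theta>\<bar> \<le> cos \<bar>\<rho> * \<theta>\<bar>"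
    using \<theta> \<rho> by (intro cos_monotone_0_pi_le) (auto simp: abs_mult mult_left_le_one_le)
  then have "cos \<theta> \<le> cos (\<rho> * \<theta>)" by (metis abs_real_def cos_minus)
  then have "norm z powr (-\<rho>) * cos \<theta> \<le> norm z powr (-\<rho>) * cos (\<rho> * \<theta>)"
    by (intro mult_left_mono) auto
  also have "norm z powr (-\<rho>) * cos (\<rho> * \<theta>) = Re (z powr (- of_real \<rho>))"
    using z0 by (simp add: powr_def Re_exp \<theta>_def)
  finally show ?thesis using c by simp
qed

text \<open>This is ln s \<le> s at s = u^\<rho> / X with X = (k + 1) / (\<rho>\<alpha>), near the
  maximum point of u^k exp(-\<alpha> u^\<rho>). Taking k + 1 instead of k keeps X positive when k =
  0.\<close>

lemma power_le_exp_powr: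
  fixes u \<alpha> \<rho> :: real
  assumes u: "u > 0" and \<alpha>: "\<alpha> > 0" and \<rho>: "\<rho> > 0"
  shows "u ^ k \<le> (real (k + 1) / (\<rho> * \<alpha>)) powr (k / \<rho>) * exp (\<alpha> * u powr \<rho>)"
proof -
  define X where "X = real (k + 1) / (\<rho> * \<alpha>)"
  have X: "X > 0" using \<alpha> \<rho> by (simp add: X_def)
  have "ln (u powr \<rho> / X) \<le> u powr \<rho> / X"
    using X u by (intro ln_bound) simp
  then have "\<rho> * ln u - ln X \<le> u powr \<rho> / X"
    using X u by (simp add: ln_div ln_powr)
  then have "(k / \<rho>) * (\<rho> * ln u - ln X) \<le> (k / \<rho>) * (u powr \<rho> / X)"
    using \<rho> by (intro mult_left_mono) auto
  also have "\<dots> = \<alpha> * u powr \<rho> * (k / (k + 1))"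
    using \<rho> \<alpha> by (simp add: X_def field_simps)
  also have "\<dots> \<le> \<alpha> * u powr \<rho>"
    using \<alpha> by (intro mult_right_le_one_le) (auto simp: field_simps)
  finally have "k * ln u \<le> (k / \<rho>) * ln X + \<alpha> * u powr \<rho>"
    using \<rho> by (simp add: right_diff_distrib)
  then have "exp (k * ln u) \<le> exp ((k / \<rho>) * ln X + \<alpha> * u powr \<rho>)" by simp
  moreover have "exp (k * ln u) = u ^ k" using u by (simp add: exp_of_nat_mult)
  moreover have "exp ((k / \<rho>) * ln X) = X powr (k / \<rho>)" using X by (simp add: powr_def)
  ultimately show ?thesis by (simp add: exp_add X_def)
qed

lemma mult_exp_minus_le:
  fixes x y :: real
  assumes "x \<le> y * exp c"
  shows "x * exp (- c) \<le> y"
proof -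
  have "x * exp (- c) \<le> (y * exp c) * exp (- c)" using assms by (rule mult_right_mono) simp
  also have "\<dots> = y" by (simp add: exp_minus)
  finally show ?thesis .
qed

locale flat_bump =
  fixes a \<rho> T :: real
  assumes a: "a > 0" and \<rho>: "0 < \<rho>" "\<rho> \<le> 1" and T: "T > 0"
begin

text \<open>The bump lives on a complex strip, where it is holomorphic, so that Cauchy's inequality
  can bound its real derivatives.\<close>

definition bump :: "complex \<Rightarrow> complex" where
  "bump z = exp (- of_real a * (z powr (- of_real \<rho>) + (of_real T - z) powr (- of_real \<rho>)))"

text \<open>The cut-off is needed at the endpoints as well: there \<open>powr\<close> of 0 is 0 by
  convention, and the formula for \<open>bump\<close>, an exponential, does not vanish.\<close>

definition \<psi> :: "nat \<Rightarrow> real \<Rightarrow> complex" where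
  "\<psi> k t = (if 0 < t \<and> t < T then (deriv ^^ k) bump (of_real t) else 0)"

lemma open_strip: "open {z. 0 < Re z \<and> Re z < T}"
  unfolding Collect_conj_eq by (intro open_Int open_halfspace_Re_gt open_halfspace_Re_lt)

lemma bump_holomorphic: "bump holomorphic_on {z. 0 < Re z \<and> Re z < T}"
  unfolding bump_def by (intro holomorphic_intros) (auto simp: complex_nonpos_Reals_iff)

lemma deriv_bump_holomorphic: "(deriv ^^ k) bump holomorphic_on {z. 0 < Re z \<and> Re z < T}"
  by (intro holomorphic_higher_deriv bump_holomorphic open_strip)

lemma \<psi>_0: "0 < t \<Longrightarrow> t < T \<Longrightarrow>
    \<psi> 0 t = of_real (exp (- a * (t powr (-\<rho>) + (T - t) powr (-\<rho>))))"
  using powr_of_real[of t "-\<rho>"] powr_of_real[of "T - t" "-\<rho>"]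
  by (simp add: \<psi>_def bump_def flip: exp_of_real)

lemma \<psi>_has_vector_derivative:
  assumes "0 < t" "t < T"
  shows "(\<psi> k has_vector_derivative \<psi> (Suc k) t) (at t)"
proof -
  have "((deriv ^^ k) bump has_field_derivative (deriv ^^ Suc k) bump (of_real t)) (at (of_real t))"
    using assms by (simp add: holomorphic_derivI[OF deriv_bump_holomorphic open_strip])
  then have "((\<lambda>t. (deriv ^^ k) bump (of_real t)) has_vector_derivative (deriv ^^ Suc k) bump (of_real t)) (at t)"
    by (rule has_vector_derivative_real_field)
  then have "((\<lambda>t. (deriv ^^ k) bump (of_real t)) has_vector_derivative \<psi> (Suc k) t) (at t)"
    using assms by (simp add: \<psi>_def)
  then show ?thesis
    by (rule has_vector_derivative_transform_within_open[of _ _ _ "{0<..<T}"])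
       (use assms in \<open>auto simp: \<psi>_def\<close>)
qed

text \<open>Cauchy's inequality on the disc of radius d/2 about t; the radius produces the factor
  2^k. On the disc the power belonging to the nearer endpoint has real part at least (2/9)
  d^(-\<rho>), and the other one has nonnegative real part.\<close>

lemma norm_\<psi>_le_dist:
  assumes t: "0 < t" "t < T"
  defines "d \<equiv> min t (T - t)"
  shows "norm (\<psi> k t) \<le> fact k * 2 ^ k * (1 / d) ^ k * exp (- (2 * a / 9) * (1 / d) powr \<rho>)"
proof -
  have d: "d > 0" "d \<le> t" "d \<le> T - t" using t by (auto simp: d_def)
  have ball: "Re z \<ge> t - d / 2" "Re z \<le> t + d / 2" "norm z \<le> t + d / 2"
    "norm (of_real T - z) \<le> (T - t) + d / 2" if "dist (of_real t) z \<le> d / 2" for z :: complex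
  proof -
    have nz: "norm (of_real t - z) \<le> d / 2" using that by (simp add: dist_norm)
    have "\<bar>Re (of_real t - z)\<bar> \<le> d / 2" using abs_Re_le_cmod nz by (rule order.trans)
    then show "Re z \<ge> t - d / 2" "Re z \<le> t + d / 2" by (auto simp: abs_real_def split: if_splits)
    have "norm z \<le> norm (complex_of_real t) + norm (of_real t - z)"
      using norm_triangle_ineq4[of "complex_of_real t" "of_real t - z"] by simp
    then show "norm z \<le> t + d / 2" using nz t by simp
    have "norm (of_real T - z) \<le> norm (complex_of_real (T - t)) + norm (of_real t - z)"
      using norm_triangle_ineq[of "complex_of_real (T - t)" "of_real t - z"] by simp
    then show "norm (of_real T - z) \<le> (T - t) + d / 2" using nz t by (simp del: of_real_diff)
  qed
  have sub: "cball (of_real t) (d / 2) \<subseteq> {z. 0 < Re z \<and> Re z < T}"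
  proof
    fix z :: complex assume "z \<in> cball (of_real t) (d / 2)"
    then have "dist (of_real t) z \<le> d / 2" by simp
    from ball(1,2)[OF this] show "z \<in> {z. 0 < Re z \<and> Re z < T}" using d by simp
  qed
  \<comment> \<open>The constant is 2/3 times 1/3: (3/2)^(-\<rho>) \<ge> 2/3 because \<rho> \<le> 1,
    and Re z / |z| is at least (d/2) / (3d/2).\<close>
  have Re_ge: "Re (z powr (- of_real \<rho>)) \<ge> (2/9) * (1 / d) powr \<rho>"
    if "norm z \<le> 3 * d / 2" "Re z \<ge> d / 2" for z :: complex
  proof -
    have z: "norm z > 0" "Re z > 0" using that d by auto
    have "(2/9) * (1 / d) powr \<rho> \<le> (3 * d / 2) powr (-\<rho>) * (1 / 3)"
    proof -
      have "(3/2::real) powr (-1) \<le> (3/2) powr (-\<rho>)" using \<rho> by (intro powr_mono) auto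
      then have "(2/3::real) \<le> (3/2) powr (-\<rho>)" by (simp add: powr_minus)
      moreover have "(3 * d / 2) powr (-\<rho>) = (3/2) powr (-\<rho>) * (1 / d) powr \<rho>"
      proof -
        have "(1 / d) powr \<rho> = d powr (-\<rho>)"
          by (simp only: powr_divide powr_one_eq_one powr_minus_divide)
        then show ?thesis by (simp only: powr_mult[symmetric]) simp
      qed
      ultimately have "(2/3) * (1 / d) powr \<rho> \<le> (3 * d / 2) powr (-\<rho>)"
        by (simp only: mult_right_mono powr_ge_zero)
      then show ?thesis by simp
    qed
    also have "\<dots> \<le> norm z powr (-\<rho>) * (Re z / norm z)"
    proof (intro mult_mono)
      show "(3 * d / 2) powr (-\<rho>) \<le> norm z powr (-\<rho>)"
        using that z \<rho> by (intro powr_mono2') auto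
      show "1 / 3 \<le> Re z / norm z" using that z by (simp add: field_simps)
    qed auto
    also have "\<dots> \<le> Re (z powr (- of_real \<rho>))"
      using z \<rho> by (intro Re_powr_minus_ge) auto
    finally show ?thesis .
  qed
  have Re_nonneg: "Re (z powr (- of_real \<rho>)) \<ge> 0" if "Re z > 0" for z :: complex
    by (rule order.trans[OF _ Re_powr_minus_ge]) (use that \<rho> in auto)
  have "norm ((deriv ^^ k) bump (of_real t))
      \<le> fact k * exp (- (2 * a / 9) * (1 / d) powr \<rho>) / (d / 2) ^ k"
  proof (rule Cauchy_inequality)
    show "bump holomorphic_on ball (of_real t) (d / 2)"
      using sub ball_subset_cball by (intro holomorphic_on_subset[OF bump_holomorphic]) blast
    show "continuous_on (cball (of_real t) (d / 2)) bump"
      using sub by (intro holomorphic_on_imp_continuous_on holomorphic_on_subset[OF bump_holomorphic])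
    show "norm (bump z) \<le> exp (- (2 * a / 9) * (1 / d) powr \<rho>)" if "norm (of_real t - z) = d / 2" for z
    proof -
      have "dist (of_real t) z \<le> d / 2" using that by (simp add: dist_norm)
      note b = ball[OF this]
      have pos: "Re z > 0" "Re (of_real T - z) > 0" using b d by auto
      have "(2/9) * (1 / d) powr \<rho> \<le> Re (z powr (- of_real \<rho>)) + Re ((of_real T - z) powr (- of_real \<rho>))"
      proof (cases "t \<le> T - t")
        case True
        then have "d = t" by (simp add: d_def)
        then have "(2/9) * (1 / d) powr \<rho> \<le> Re (z powr (- of_real \<rho>))" using b by (intro Re_ge) auto
        then show ?thesis using Re_nonneg[OF pos(2)] by simp
      next
        case False
        then have eq: "d = T - t" by (simp add: d_def)
        have "norm (of_real T - z) \<le> 3 * d / 2" using b(4) eq by linarith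
        moreover have "Re (of_real T - z) = T - Re z" by simp
        then have "Re (of_real T - z) \<ge> d / 2" using b(2) eq by linarith
        ultimately have "(2/9) * (1 / d) powr \<rho> \<le> Re ((of_real T - z) powr (- of_real \<rho>))"
          by (rule Re_ge)
        then show ?thesis using Re_nonneg[OF pos(1)] by simp
      qed
      then have "a * ((2/9) * (1 / d) powr \<rho>) \<le> a * (Re (z powr (- of_real \<rho>)) + Re ((of_real T - z) powr (- of_real \<rho>)))"
        using a by (intro mult_left_mono) auto
      then show ?thesis by (simp add: bump_def algebra_simps)
    qed
  qed (use d in simp)
  also have "\<dots> = fact k * 2 ^ k * (1 / d) ^ k * exp (- (2 * a / 9) * (1 / d) powr \<rho>)"
    using d by (simp add: power_divide field_simps)
  finally show ?thesis using t by (simp add: \<psi>_def)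
qed

text \<open>Applying \<open>power_le_exp_powr\<close> to u = 1/d removes the dependence on t, and k!
  \<le> (k + 1)^k. The result is Gevrey growth of order 1 + 1/\<rho>, with a geometric ratio that
  tends to 0 as \<open>a\<close> grows.\<close>

lemma norm_\<psi>_le:
  "norm (\<psi> k t) \<le> (2 * (2 * a * \<rho> / 9) powr (- 1 / \<rho>) * real (k + 1) powr (1 + 1 / \<rho>)) ^ k"
proof (cases "0 < t \<and> t < T")
  case True
  then have t: "0 < t" "t < T" by auto
  define u where "u = 1 / min t (T - t)"
  have u: "u > 0" using t by (simp add: u_def)
  have c: "\<rho> * (2 * a / 9) > 0" using a \<rho> by simp
  have "norm (\<psi> k t) \<le> fact k * 2 ^ k * (u ^ k * exp (- (2 * a / 9) * u powr \<rho>))"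
    using norm_\<psi>_le_dist[OF t, of k] by (simp add: u_def mult_ac)
  also have "\<dots> \<le> fact k * 2 ^ k * (real (k + 1) / (\<rho> * (2 * a / 9))) powr (k / \<rho>)"
  proof (intro mult_left_mono)
    have "u ^ k \<le> (real (k + 1) / (\<rho> * (2 * a / 9))) powr (k / \<rho>) * exp ((2 * a / 9) * u powr \<rho>)"
      using u a \<rho> by (intro power_le_exp_powr) auto
    then show "u ^ k * exp (- (2 * a / 9) * u powr \<rho>) \<le> (real (k + 1) / (\<rho> * (2 * a / 9))) powr (k / \<rho>)"
      by (simp add: exp_minus field_simps)
  qed auto
  also have "\<dots> \<le> real (k + 1) ^ k * 2 ^ k * (real (k + 1) / (\<rho> * (2 * a / 9))) powr (k / \<rho>)"
  proof (intro mult_right_mono)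
    have "(fact k :: real) \<le> real (k ^ k)" by (rule fact_le_power)
    also have "\<dots> \<le> real (k + 1) ^ k" by (simp add: power_mono)
    finally show "(fact k :: real) \<le> real (k + 1) ^ k" .
  qed auto
  also have "(real (k + 1) / (\<rho> * (2 * a / 9))) powr (k / \<rho>) =
      (real (k + 1) powr (1 / \<rho>) / (2 * a * \<rho> / 9) powr (1 / \<rho>)) ^ k"
  proof -
    have "(real (k + 1) / (\<rho> * (2 * a / 9))) powr (k / \<rho>) =
        ((real (k + 1) / (\<rho> * (2 * a / 9))) powr (1 / \<rho>)) ^ k"
      by (subst powr_power) (use a \<rho> in auto)
    moreover have "\<rho> * (2 * a / 9) = 2 * a * \<rho> / 9" by simp
    moreover have "(real (k + 1) / (2 * a * \<rho> / 9)) powr (1 / \<rho>) =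
        real (k + 1) powr (1 / \<rho>) / (2 * a * \<rho> / 9) powr (1 / \<rho>)"
      by (rule powr_divide)
    ultimately show ?thesis by (simp only:)
  qed
  also have "real (k + 1) ^ k * 2 ^ k * (real (k + 1) powr (1 / \<rho>) / (2 * a * \<rho> / 9) powr (1 / \<rho>)) ^ k
     = (2 * (2 * a * \<rho> / 9) powr (- 1 / \<rho>) * real (k + 1) powr (1 + 1 / \<rho>)) ^ k"
  proof -
    have "real (k + 1) powr (1 + 1 / \<rho>) = real (k + 1) * real (k + 1) powr (1 / \<rho>)"
      by (simp add: powr_add)
    moreover have "(2 * a * \<rho> / 9) powr (- 1 / \<rho>) = inverse ((2 * a * \<rho> / 9) powr (1 / \<rho>))"
      by (simp only: minus_divide_left[symmetric] powr_minus)
    ultimately show ?thesis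
      by (simp only: power_mult_distrib divide_inverse mult_ac)
  qed
  finally show ?thesis .
next
  case False
  then show ?thesis by (auto simp: \<psi>_def)
qed

text \<open>Bounding one extra power of 1/d by the exponential leaves a factor d. This linear
  vanishing at 0 and T gives continuity on the closed interval.\<close>

lemma norm_\<psi>_le_endpoints:
  obtains K where "\<And>t. 0 \<le> t \<Longrightarrow> norm (\<psi> k t) \<le> K * t"
    "\<And>t. t \<le> T \<Longrightarrow> norm (\<psi> k t) \<le> K * (T - t)" "K \<ge> 0"
proof -
  define X where "X = (real (Suc k + 1) / (\<rho> * (2 * a / 9))) powr (Suc k / \<rho>)"
  define K where "K = fact k * 2 ^ k * X"
  have K: "K \<ge> 0" by (simp add: K_def X_def)
  have main: "norm (\<psi> k t) \<le> K * min t (T - t)" if t: "0 < t" "t < T" for t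
  proof -
    define d where "d = min t (T - t)"
    have d: "d > 0" using t by (simp add: d_def)
    have "(1 / d) ^ Suc k \<le> X * exp ((2 * a / 9) * (1 / d) powr \<rho>)"
      unfolding X_def using d a \<rho> by (intro power_le_exp_powr) auto
    then have "(1 / d) ^ Suc k * exp (- ((2 * a / 9) * (1 / d) powr \<rho>)) \<le> X"
      by (rule mult_exp_minus_le)
    then have "(1 / d) ^ Suc k * exp (- (2 * a / 9) * (1 / d) powr \<rho>) \<le> X"
      by (simp only: mult_minus_left)
    then have "d * ((1 / d) ^ Suc k * exp (- (2 * a / 9) * (1 / d) powr \<rho>)) \<le> d * X"
      by (rule mult_left_mono) (use d in simp)
    moreover have "d * ((1 / d) ^ Suc k * e) = (1 / d) ^ k * e" for e
      using d by simp
    ultimately have *: "(1 / d) ^ k * exp (- (2 * a / 9) * (1 / d) powr \<rho>) \<le> d * X"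
      by (simp only:)
    have "norm (\<psi> k t) \<le> fact k * 2 ^ k * ((1 / d) ^ k * exp (- (2 * a / 9) * (1 / d) powr \<rho>))"
      using norm_\<psi>_le_dist[OF t, of k] by (simp only: d_def mult.assoc)
    also have "\<dots> \<le> fact k * 2 ^ k * (d * X)"
      using * by (rule mult_left_mono) simp
    also have "\<dots> = K * min t (T - t)" by (simp only: K_def d_def mult_ac)
    finally show ?thesis .
  qed
  show thesis
  proof (rule that[OF _ _ K])
    show "norm (\<psi> k t) \<le> K * t" if "0 \<le> t" for t
    proof (cases "0 < t \<and> t < T")
      case True
      then have "norm (\<psi> k t) \<le> K * min t (T - t)" by (intro main) auto
      also have "\<dots> \<le> K * t" using K by (intro mult_left_mono) auto
      finally show ?thesis .
    qed (use that K in \<open>auto simp: \<psi>_def\<close>)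
    show "norm (\<psi> k t) \<le> K * (T - t)" if "t \<le> T" for t
    proof (cases "0 < t \<and> t < T")
      case True
      then have "norm (\<psi> k t) \<le> K * min t (T - t)" by (intro main) auto
      also have "\<dots> \<le> K * (T - t)" using K by (intro mult_left_mono) auto
      finally show ?thesis .
    qed (use that K in \<open>auto simp: \<psi>_def\<close>)
  qed
qed

lemma continuous_on_\<psi>: "continuous_on {0..T} (\<psi> k)"
proof -
  obtain K where K: "\<And>t. 0 \<le> t \<Longrightarrow> norm (\<psi> k t) \<le> K * t"
    "\<And>t. t \<le> T \<Longrightarrow> norm (\<psi> k t) \<le> K * (T - t)" using norm_\<psi>_le_endpoints by blast
  have "continuous (at t within {0..T}) (\<psi> k)" if t: "t \<in> {0..T}" for t
  proof -
    consider "t = 0" | "t = T" | "0 < t" "t < T" using t by force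
    then show ?thesis
    proof cases
      case 1
      have "(\<psi> k \<longlongrightarrow> 0) (at 0 within {0..T})"
      proof (rule Lim_null_comparison)
        show "\<forall>\<^sub>F x in at 0 within {0..T}. norm (\<psi> k x) \<le> K * x"
          using K(1) by (simp add: eventually_at_filter)
        show "((\<lambda>x. K * x) \<longlongrightarrow> 0) (at 0 within {0..T})" by (auto intro!: tendsto_eq_intros)
      qed
      then show ?thesis using 1 by (simp add: continuous_within \<psi>_def)
    next
      case 2
      have "(\<psi> k \<longlongrightarrow> 0) (at T within {0..T})"
      proof (rule Lim_null_comparison)
        show "\<forall>\<^sub>F x in at T within {0..T}. norm (\<psi> k x) \<le> K * (T - x)"
          using K(2) by (simp add: eventually_at_filter)
        show "((\<lambda>x. K * (T - x)) \<longlongrightarrow> 0) (at T within {0..T})" by (auto intro!: tendsto_eq_intros)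
      qed
      then show ?thesis using 2 by (simp add: continuous_within \<psi>_def)
    next
      case 3
      then show ?thesis
        by (meson \<psi>_has_vector_derivative continuous_at_imp_continuous_at_within has_vector_derivative_continuous)
    qed
  qed
  then show ?thesis by (simp add: continuous_on_eq_continuous_within)
qed

section \<open>The Fourier-Laplace transform of the bump\<close>

definition M :: "complex \<Rightarrow> complex" where
  "M w = integral {0..T} (\<lambda>t. \<psi> 0 t * exp (\<i> * w * of_real t))"

text \<open>Integration by parts; the boundary terms vanish because \<open>\<psi> k\<close> does at both ends.\<close>
lemma has_integral_\<psi>_exp:
  "((\<lambda>t. \<psi> k t * exp (\<i> * w * of_real t)) has_integral (- \<i> * w) ^ k * M w) {0..T}"
proof (induction k)
  case 0
  have "(\<lambda>t. \<psi> 0 t * exp (\<i> * w * of_real t)) integrable_on {0..T}"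
    by (intro integrable_continuous_real continuous_intros continuous_on_\<psi>)
  then show ?case by (simp add: M_def has_integral_integral)
next
  case (Suc k)
  show ?case
  proof (rule integration_by_parts_interior[where prod = "(*)" and g' = "\<lambda>t. \<i> * w * exp (\<i> * w * of_real t)"])
    show "((\<lambda>t. exp (\<i> * w * of_real t)) has_vector_derivative \<i> * w * exp (\<i> * w * of_real x)) (at x)" for x :: real
      by (rule has_vector_derivative_real_field) (auto intro!: derivative_eq_intros)
    have "((\<lambda>t. \<i> * w * (\<psi> k t * exp (\<i> * w * of_real t))) has_integral \<i> * w * ((- \<i> * w) ^ k * M w)) {0..T}"
      by (rule has_integral_mult_right[OF Suc.IH])
    then show "((\<lambda>x. \<psi> k x * (\<i> * w * exp (\<i> * w * of_real x))) has_integral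
        \<psi> k T * exp (\<i> * w * of_real T) - \<psi> k 0 * exp (\<i> * w * of_real 0) - (- \<i> * w) ^ Suc k * M w) {0..T}"
      by (simp add: \<psi>_def mult_ac)
  qed (use T in \<open>auto intro!: continuous_intros continuous_on_\<psi> \<psi>_has_vector_derivative bounded_bilinear_mult\<close>)
qed

end

subsection \<open>Multipliers acting on the bump\<close>

text \<open>The fractions x/(x + y) and y/(x + y) sum to 1, and s \<le> s^\<kappa> on [0, 1]. Used
  to recentre growth bounds.\<close>

lemma powr_add_le:
  fixes x y \<kappa> :: real
  assumes "x \<ge> 0" "y \<ge> 0" "0 < \<kappa>" "\<kappa> \<le> 1"
  shows "(x + y) powr \<kappa> \<le> x powr \<kappa> + y powr \<kappa>"
proof (cases "x + y = 0")
  case False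
  with assms have s: "x + y > 0" by simp
  have *: "x / (x + y) \<le> (x / (x + y)) powr \<kappa>" if "x \<ge> 0" "y \<ge> 0" "x + y > 0" for x y
  proof (cases "x = 0")
    case False
    then have "(x / (x + y)) powr 1 \<le> (x / (x + y)) powr \<kappa>"
      using that assms by (intro powr_mono') auto
    then show ?thesis using that False by simp
  qed simp
  have "1 = x / (x + y) + y / (x + y)" using s by (simp only: add_divide_distrib[symmetric] divide_self_if) simp
  also have "\<dots> \<le> (x / (x + y)) powr \<kappa> + (y / (x + y)) powr \<kappa>"
    using assms s *[of y x] by (intro add_mono *) (simp_all only: add.commute)
  also have "\<dots> = (x powr \<kappa> + y powr \<kappa>) / (x + y) powr \<kappa>"
    using assms by (simp add: powr_divide add_divide_distrib)
  finally have "1 \<le> (x powr \<kappa> + y powr \<kappa>) / (x + y) powr \<kappa>" .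
  moreover have "(x + y) powr \<kappa> > 0" using s by simp
  ultimately show ?thesis by (simp only: pos_le_divide_eq mult_1)
qed (use assms in simp)

text \<open>Differentiation under the integral: pairing with t e^(izt) becomes, up to the factor i,
  a derivative of the transform.\<close>

lemma has_field_derivative_integral_exp:
  fixes h :: "real \<Rightarrow> complex"
  assumes h: "continuous_on {0..T} h"
  shows "((\<lambda>z. integral {0..T} (\<lambda>t. h t * exp (\<i> * z * of_real t))) has_field_derivative
     \<i> * integral {0..T} (\<lambda>t. of_real t * h t * exp (\<i> * z * of_real t))) (at z)"
proof -
  have "((\<lambda>z. integral (cbox 0 T) (\<lambda>t. h t * exp (\<i> * z * of_real t))) has_field_derivative
     integral (cbox 0 T) (\<lambda>t. h t * (\<i> * of_real t * exp (\<i> * z * of_real t)))) (at z within UNIV)"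
  proof (rule leibniz_rule_field_derivative)
    show "((\<lambda>x. h t * exp (\<i> * x * of_real t)) has_field_derivative
        h t * (\<i> * of_real t * exp (\<i> * x * of_real t))) (at x within UNIV)" for x t
      by (auto intro!: derivative_eq_intros)
    show "(\<lambda>t. h t * exp (\<i> * x * complex_of_real t)) integrable_on cbox 0 T" for x
      using h by (intro integrable_continuous continuous_intros) auto
    have "continuous_on (UNIV \<times> cbox 0 T) (\<lambda>p. h (snd p))"
      by (rule continuous_on_compose2[OF h continuous_on_snd[OF continuous_on_id]]) auto
    then show "continuous_on (UNIV \<times> cbox 0 T)
        (\<lambda>(x, t). h t * (\<i> * complex_of_real t * exp (\<i> * x * complex_of_real t)))"
      unfolding case_prod_unfold by (intro continuous_intros)
  qed auto
  moreover have "integral (cbox 0 T) (\<lambda>t. h t * (\<i> * of_real t * exp (\<i> * z * of_real t))) =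
      \<i> * integral {0..T} (\<lambda>t. of_real t * h t * exp (\<i> * z * of_real t))"
  proof -
    have "h t * (\<i> * of_real t * exp (\<i> * z * of_real t)) = \<i> * (of_real t * h t * exp (\<i> * z * of_real t))" for t
      by (simp only: mult_ac)
    then show ?thesis by (simp only: integral_mult_right interval_cbox)
  qed
  ultimately show ?thesis by (simp only: interval_cbox)
qed

context flat_bump
begin

text \<open>The function \<open>h\<close> is obtained by applying the differential operator of infinite order with symbol
  \<open>S\<close> to the bump. The Taylor coefficients of \<open>S\<close> decay like \<open>k powr (- k / \<kappa>)\<close>, which
  is exactly the rate at which the derivatives of the bump may grow; a large \<open>a\<close> wins the
  remaining geometric factor.\<close>
lemma multiplier_transform:
  assumes S: "S holomorphic_on UNIV" and B: "B \<ge> 0"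
    and bound: "\<And>w. norm (S w) \<le> B * exp (A * norm w powr (\<rho> / (1 + \<rho>)))"
    and small: "exp A * (2 * (2 * a * \<rho> / 9) powr (- 1 / \<rho>)) \<le> 1 / 2"
  obtains h where "continuous_on {0..T} h" "\<And>t. norm (h t) \<le> 2 * B * exp A"
    "\<And>w. integral {0..T} (\<lambda>t. h t * exp (\<i> * w * of_real t)) = S w * M w"
proof -
  define s where "s = (\<lambda>k. (deriv ^^ k) S 0 / fact k)"
  \<comment> \<open>The factor \<open>\<i> ^ k\<close> cancels the powers of -i from integration by
    parts, so the transform of \<open>f k\<close> is \<open>s k * w ^ k * M w\<close>.\<close>
  define f where "f = (\<lambda>k t. s k * \<i> ^ k * \<psi> k t)"
  have s_le: "norm (s k) \<le> B * exp A * exp A ^ k / (real (k + 1) powr (1 + 1 / \<rho>)) ^ k" for k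
  proof -
    \<comment> \<open>The Cauchy radius is chosen so that r^(\<rho>/(1 + \<rho>)) = k + 1: the
      growth of \<open>S\<close> then costs only a geometric factor, while r^k matches the growth of
      \<open>\<psi> k\<close>.\<close>
    define r where "r = real (k + 1) powr (1 + 1 / \<rho>)"
    have r: "r > 0" by (simp add: r_def)
    have "(1 + 1 / \<rho>) * (\<rho> / (1 + \<rho>)) = 1" using \<rho> by (simp add: divide_simps)
    then have rk: "r powr (\<rho> / (1 + \<rho>)) = real (k + 1)" by (simp only: r_def powr_powr) simp
    have "norm ((deriv ^^ k) S 0) \<le> fact k * (B * exp (A * real (k + 1))) / r ^ k"
    proof (rule Cauchy_inequality)
      show "S holomorphic_on ball 0 r" using S by (rule holomorphic_on_subset) auto
      show "continuous_on (cball 0 r) S"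
        using S by (meson continuous_on_subset holomorphic_on_imp_continuous_on subset_UNIV)
      show "norm (S x) \<le> B * exp (A * real (k + 1))" if "norm (0 - x) = r" for x
      proof -
        have "norm x powr (\<rho> / (1 + \<rho>)) = real (k + 1)" using that rk by simp
        then show ?thesis using bound[of x] by (simp only:)
      qed
    qed (use r in simp)
    then have "norm (s k) \<le> B * exp (A * real (k + 1)) / r ^ k"
      by (simp add: s_def norm_divide pos_divide_le_eq mult.commute)
    also have "exp (A * real (k + 1)) = exp A * exp A ^ k"
      by (simp only: exp_of_nat2_mult power_add power_one_right mult.commute)
    finally show ?thesis by (simp add: r_def)
  qed
  have f_le: "norm (f k t) \<le> B * exp A * (1 / 2) ^ k" for k t
  proof -
    define W where "W = real (k + 1) powr (1 + 1 / \<rho>)"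
    define D where "D = 2 * (2 * a * \<rho> / 9) powr (- 1 / \<rho>)"
    have W: "W > 0" by (simp add: W_def)
    have D: "D \<ge> 0" by (simp add: D_def)
    have "norm (f k t) = norm (s k) * norm (\<psi> k t)"
      by (simp add: f_def norm_mult norm_power)
    also have "\<dots> \<le> (B * exp A * exp A ^ k / W ^ k) * (D * W) ^ k"
      unfolding W_def D_def using s_le norm_\<psi>_le
      by (rule mult_mono) (use B in simp_all)
    \<comment> \<open>The factors \<open>W ^ k\<close> cancel exactly; \<open>small\<close> says
      that the remaining ratio is at most 1/2.\<close>
    also have "\<dots> = B * exp A * (exp A * D) ^ k"
      using W by (simp add: power_mult_distrib)
    also have "\<dots> \<le> B * exp A * (1 / 2) ^ k"
    proof (intro mult_left_mono power_mono)
      show "exp A * D \<le> 1 / 2" using small by (simp only: D_def)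
    qed (use B D in simp_all)
    finally show ?thesis .
  qed
  define h where "h = (\<lambda>t. \<Sum>k. f k t)"
  have geo: "(\<lambda>k. B * exp A * (1 / 2) ^ k) sums (2 * B * exp A)"
    using sums_mult[OF geometric_sums[of "1/2 :: real"], of "B * exp A"] by (simp add: mult_ac)
  note sgeo = sums_summable[OF geo]
  have summ_norm: "summable (\<lambda>k. norm (f k t))" for t
    by (rule summable_comparison_test'[OF sgeo, of 0]) (use f_le in simp)
  have summ: "summable (\<lambda>k. f k t)" for t
    by (rule summable_norm_cancel[OF summ_norm])
  have contf: "continuous_on {0..T} (f k)" for k
    unfolding f_def by (intro continuous_intros continuous_on_\<psi>)
  have conth: "continuous_on {0..T} h"
  proof (rule uniform_limit_theorem)
    show "uniform_limit {0..T} (\<lambda>n t. \<Sum>k<n. f k t) h sequentially"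
      unfolding h_def by (rule Weierstrass_m_test[OF f_le sgeo])
    show "\<forall>\<^sub>F n in sequentially. continuous_on {0..T} (\<lambda>t. \<Sum>k<n. f k t)"
      by (intro always_eventually allI continuous_on_sum contf)
  qed simp
  have norm_h: "norm (h t) \<le> 2 * B * exp A" for t
  proof -
    have "norm (h t) \<le> (\<Sum>k. norm (f k t))"
      unfolding h_def by (rule summable_norm[OF summ_norm])
    also have "\<dots> \<le> (\<Sum>k. B * exp A * (1 / 2) ^ k)"
      by (rule suminf_le[OF f_le summ_norm sgeo])
    also have "\<dots> = 2 * B * exp A" using geo by (rule sums_unique[symmetric])
    finally show ?thesis .
  qed
  have "integral {0..T} (\<lambda>t. h t * exp (\<i> * w * of_real t)) = S w * M w" for w
  proof -
    let ?g = "\<lambda>n t. \<Sum>k<n. f k t * exp (\<i> * w * of_real t)"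
    have ul: "uniform_limit {0..T} ?g (\<lambda>t. \<Sum>k. f k t * exp (\<i> * w * of_real t)) sequentially"
    proof (rule Weierstrass_m_test)
      show "summable (\<lambda>k. B * exp A * (1 / 2) ^ k * exp (norm w * T))"
        by (rule summable_mult2[OF sgeo])
      show "norm (f k t * exp (\<i> * w * of_real t)) \<le> B * exp A * (1 / 2) ^ k * exp (norm w * T)"
        if "t \<in> {0..T}" for k t
      proof -
        have "norm (exp (\<i> * w * of_real t)) \<le> exp (norm (\<i> * w * of_real t))" by (rule norm_exp)
        also have "\<dots> \<le> exp (norm w * T)" using that by (simp add: norm_mult mult_left_mono)
        finally show ?thesis using f_le[of k t] B unfolding norm_mult by (intro mult_mono) auto
      qed
    qed
    have gh: "(\<lambda>t. \<Sum>k. f k t * exp (\<i> * w * of_real t)) = (\<lambda>t. h t * exp (\<i> * w * of_real t))"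
      unfolding h_def using summ by (simp add: suminf_mult2)
    obtain I J where IJ: "\<And>n. (?g n has_integral I n) {0..T}"
      "((\<lambda>t. h t * exp (\<i> * w * of_real t)) has_integral J) {0..T}" "I \<longlonglongrightarrow> J"
    proof (rule uniform_limit_integral[OF ul[unfolded gh]])
      show "continuous_on {0..T} (?g n)" for n by (intro continuous_intros contf)
    qed (simp, blast)
    have I: "I n = (\<Sum>k<n. s k * w ^ k) * M w" for n
    proof -
      have "((\<lambda>t. f k t * exp (\<i> * w * of_real t)) has_integral s k * w ^ k * M w) {0..T}" for k
      proof -
        have "((\<lambda>t. s k * \<i> ^ k * (\<psi> k t * exp (\<i> * w * of_real t))) has_integral
            s k * \<i> ^ k * ((- \<i> * w) ^ k * M w)) {0..T}"
          by (rule has_integral_mult_right[OF has_integral_\<psi>_exp])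
        moreover have eq: "\<i> ^ k * (- \<i> * w) ^ k = w ^ k"
          by (simp flip: power_mult_distrib)
        have "s k * \<i> ^ k * ((- \<i> * w) ^ k * M w) = s k * (\<i> ^ k * (- \<i> * w) ^ k) * M w"
          by (simp only: mult.assoc)
        then have "s k * \<i> ^ k * ((- \<i> * w) ^ k * M w) = s k * w ^ k * M w"
          unfolding eq .
        ultimately show ?thesis by (simp only: f_def mult.assoc)
      qed
      then have "(?g n has_integral (\<Sum>k<n. s k * w ^ k * M w)) {0..T}"
        by (intro has_integral_sum) auto
      then have "(?g n has_integral (\<Sum>k<n. s k * w ^ k) * M w) {0..T}"
        by (simp only: sum_distrib_right)
      then show ?thesis using IJ(1) has_integral_unique by blast
    qed
    have "(\<lambda>k. s k * (w - 0) ^ k) sums S w"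
      unfolding s_def using S
      by (intro holomorphic_power_series[of _ _ "norm w + 1"]) (auto intro: holomorphic_on_subset)
    then have "I \<longlonglongrightarrow> S w * M w"
      unfolding I by (auto simp: sums_def intro!: tendsto_mult)
    then have "J = S w * M w" using IJ(3) LIMSEQ_unique by blast
    then show ?thesis using IJ(2) by (simp add: integral_unique)
  qed
  then show thesis using that conth norm_h by blast
qed

section \<open>The transform on the imaginary axis\<close>

definition \<phi> :: "real \<Rightarrow> real" where
  "\<phi> t = (if 0 < t \<and> t < T then exp (- a * (t powr (-\<rho>) + (T - t) powr (-\<rho>))) else 0)"

definition lap :: "real \<Rightarrow> real" where
  "lap y = integral {0..T} (\<lambda>t. \<phi> t * exp (- (y * t)))"

lemma \<psi>_0_eq: "\<psi> 0 t = of_real (\<phi> t)"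
proof (cases "0 < t \<and> t < T")
  case True
  then show ?thesis using \<psi>_0[of t] by (simp add: \<phi>_def)
next
  case False
  then show ?thesis by (auto simp: \<psi>_def \<phi>_def)
qed

lemma continuous_on_\<phi>: "continuous_on {0..T} \<phi>"
proof -
  have "\<phi> = (\<lambda>t. Re (\<psi> 0 t))" by (simp add: \<psi>_0_eq)
  then show ?thesis using continuous_on_\<psi>[of 0] by (simp add: continuous_on_Re)
qed

lemma M_imaginary: "M (\<i> * of_real y) = of_real (lap y)"
proof -
  have "((\<lambda>t. \<phi> t * exp (- (y * t))) has_integral lap y) {0..T}"
    unfolding lap_def
    by (intro integrable_integral integrable_continuous_real continuous_intros continuous_on_\<phi>)
  then have "((\<lambda>t. complex_of_real (\<phi> t * exp (- (y * t)))) has_integral of_real (lap y)) {0..T}"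
    by (rule has_integral_of_real)
  moreover have "complex_of_real (\<phi> t * exp (- (y * t))) = \<psi> 0 t * exp (\<i> * (\<i> * of_real y) * of_real t)" for t
    by (simp add: \<psi>_0_eq flip: exp_of_real mult.assoc)
  ultimately show ?thesis unfolding M_def by (simp add: integral_unique)
qed

definition M1 :: "complex \<Rightarrow> complex" where
  "M1 w = integral {0..T} (\<lambda>t. of_real t * \<psi> 0 t * exp (\<i> * w * of_real t))"

lemma M_has_field_derivative: "(M has_field_derivative \<i> * M1 w) (at w)"
  unfolding M_def[abs_def] M1_def by (intro has_field_derivative_integral_exp continuous_on_\<psi>)

text \<open>Since \<phi> \<ge> 0, the weight t costs at most T. Hence the logarithmic derivative of
  \<open>M\<close> at iy is bounded by T wherever \<open>lap y\<close> is positive, uniformly in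
  y.\<close>

lemma norm_M1_imaginary_le: "norm (M1 (\<i> * of_real y)) \<le> T * lap y"
proof -
  have "norm (M1 (\<i> * of_real y)) \<le> integral {0..T} (\<lambda>t. T * (\<phi> t * exp (- (y * t))))"
    unfolding M1_def
  proof (rule integral_norm_bound_integral)
    show "(\<lambda>t. of_real t * \<psi> 0 t * exp (\<i> * (\<i> * complex_of_real y) * complex_of_real t)) integrable_on {0..T}"
      by (intro integrable_continuous_real continuous_intros continuous_on_\<psi>)
    show "(\<lambda>t. T * (\<phi> t * exp (- (y * t)))) integrable_on {0..T}"
      by (intro integrable_continuous_real continuous_intros continuous_on_\<phi>)
    show "norm (of_real t * \<psi> 0 t * exp (\<i> * (\<i> * complex_of_real y) * complex_of_real t))
        \<le> T * (\<phi> t * exp (- (y * t)))" if "t \<in> {0..T}" for t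
    proof -
      have "exp (\<i> * (\<i> * complex_of_real y) * complex_of_real t) = of_real (exp (- (y * t)))"
        by (simp flip: exp_of_real mult.assoc)
      moreover have "\<phi> t \<ge> 0" by (simp add: \<phi>_def)
      ultimately show ?thesis using that
        by (simp add: norm_mult \<psi>_0_eq mult_right_mono mult.assoc)
    qed
  qed
  also have "\<dots> = T * lap y" by (simp add: lap_def)
  finally show ?thesis .
qed

text \<open>On \<open>[s, 2 s]\<close> with \<open>s\<close> of order \<open>y powr (\<kappa> - 1)\<close> the exponents \<open>a * s powr - \<rho>\<close> and
  \<open>y * s\<close> are both of order \<open>y powr \<kappa>\<close>.\<close>
lemma lap_lower_bound:
  obtains c K where "c > 0" "K > 0" "\<And>y. y > 0 \<Longrightarrow> c * exp (- (K * y powr (\<rho> / (1 + \<rho>)))) \<le> lap y"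
proof -
  define \<kappa> where "\<kappa> = \<rho> / (1 + \<rho>)"
  have \<kappa>: "0 < \<kappa>" "\<kappa> < 1" "(\<kappa> - 1) * (-\<rho>) = \<kappa>" using \<rho> by (auto simp: \<kappa>_def field_simps)
  \<comment> \<open>The three terms pay for the bump near 0, for the factor exp(-yt) with t \<le>
    2s, and for the length s of the interval. In \<open>c0\<close>, the exponential pays for the
    endpoint T, at distance at least T/2.\<close>
  define K where "K = a * (T / 4) powr (-\<rho>) + T / 2 + 1 / \<kappa>"
  define c0 where "c0 = T / 4 * exp (- a * (T / 2) powr (-\<rho>))"
  have K: "K > 0" using a T \<kappa> by (auto simp: K_def intro!: add_nonneg_pos)
  have c0: "c0 > 0" using T by (simp add: c0_def)
  have "c0 * exp (- K) * exp (- (K * y powr \<kappa>)) \<le> lap y" if y: "y > 0" for y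
  proof -
    \<comment> \<open>Using 1 + y instead of y keeps s \<le> T/4 for small y too, so that [s, 2s]
      lies in the left half of the interval. Returning to y^\<kappa> costs the constant factor
      exp(-K).\<close>
    define Y where "Y = (1 + y) powr \<kappa>"
    define s where "s = (T / 4) * (1 + y) powr (\<kappa> - 1)"
    have s: "s > 0" using T y by (simp add: s_def)
    have "(1 + y) powr (\<kappa> - 1) \<le> (1 + y) powr 0" using \<kappa> y by (intro powr_mono) auto
    then have s4: "s \<le> T / 4" using T y by (simp add: s_def mult_left_le)
    have sy: "s * y \<le> T / 4 * Y"
    proof -
      have "s * y \<le> s * (1 + y)" using s by simp
      also have "\<dots> = T / 4 * Y" using y by (simp add: s_def Y_def powr_mult_base mult.assoc mult.commute[of _ "1 + y"])
      finally show ?thesis .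
    qed
    have s\<rho>: "s powr (-\<rho>) = (T / 4) powr (-\<rho>) * Y"
    proof -
      have "s powr (-\<rho>) = (T / 4) powr (-\<rho>) * ((1 + y) powr (\<kappa> - 1)) powr (-\<rho>)"
        unfolding s_def using T y by (intro powr_mult) 
      then show ?thesis by (simp only: powr_powr \<kappa>(3) Y_def)
    qed
    \<comment> \<open>The length s decays only polynomially in y, and ln(1 + y) \<le> Y/\<kappa>
      absorbs this into the exponential.\<close>
    have s_ge: "T / 4 * exp (- (Y / \<kappa>)) \<le> s"
    proof -
      have "ln Y \<le> Y" using y by (intro ln_bound) (simp add: Y_def)
      then have "\<kappa> * ln (1 + y) \<le> Y" using y by (simp add: Y_def ln_powr)
      then have "ln (1 + y) \<le> Y / \<kappa>" using \<kappa> by (simp add: field_simps)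
      then have "- (Y / \<kappa>) \<le> - ln (1 + y)" by simp
      also have "\<dots> \<le> (\<kappa> - 1) * ln (1 + y)" using \<kappa> y by (simp add: algebra_simps)
      finally have "exp (- (Y / \<kappa>)) \<le> (1 + y) powr (\<kappa> - 1)" using y by (simp add: powr_def)
      then show ?thesis using T by (simp add: s_def)
    qed
    define E where "E = exp (- a * (s powr (-\<rho>) + (T / 2) powr (-\<rho>))) * exp (- (2 * s * y))"
    have pt: "E \<le> \<phi> t * exp (- (y * t))" if t: "t \<in> {s..2 * s}" for t
    proof -
      have t': "0 < t" "t < T" "T / 2 \<le> T - t" using t s s4 T by auto
      have "t powr (-\<rho>) \<le> s powr (-\<rho>)" using t s \<rho> by (intro powr_mono2') auto
      moreover have "(T - t) powr (-\<rho>) \<le> (T / 2) powr (-\<rho>)" using t' T \<rho> by (intro powr_mono2') auto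
      ultimately have "a * (t powr (-\<rho>) + (T - t) powr (-\<rho>)) \<le> a * (s powr (-\<rho>) + (T / 2) powr (-\<rho>))"
        using a by (intro mult_left_mono) auto
      moreover have "y * t \<le> 2 * s * y" using t y by (simp add: mult.commute)
      ultimately show ?thesis
        unfolding E_def \<phi>_def using t' by (auto intro!: mult_mono)
    qed
    have int: "(\<lambda>t. \<phi> t * exp (- (y * t))) integrable_on {0..T}"
      by (intro integrable_continuous_real continuous_intros continuous_on_\<phi>)
    have sub: "{s..2 * s} \<subseteq> {0..T}" using s s4 T by auto
    have exps: "c0 * exp (- (K * Y)) = T / 4 * exp (- (Y / \<kappa>)) * (exp (- a * ((T / 4) powr (-\<rho>) * Y + (T / 2) powr (-\<rho>))) * exp (- (T / 2 * Y)))"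
      by (simp add: c0_def K_def algebra_simps add_divide_distrib flip: exp_add)
    have "Y \<le> 1 + y powr \<kappa>" using powr_add_le[of 1 y \<kappa>] \<kappa> y by (simp add: Y_def)
    then have "K * Y \<le> K * (1 + y powr \<kappa>)" using K by (intro mult_left_mono) auto
    then have "K * Y \<le> K + K * y powr \<kappa>" by (simp add: distrib_left)
    then have "c0 * exp (- (K + K * y powr \<kappa>)) \<le> c0 * exp (- (K * Y))" using c0 by simp
    also have "\<dots> \<le> s * E"
      unfolding exps E_def s\<rho> using s_ge sy s T by (intro mult_mono) auto
    also have "\<dots> = integral {s..2 * s} (\<lambda>t. E)" using s by simp
    also have "\<dots> \<le> integral {s..2 * s} (\<lambda>t. \<phi> t * exp (- (y * t)))"
      using pt int sub by (intro integral_le) (auto intro: integrable_on_subinterval)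
    also have "\<dots> \<le> lap y"
      unfolding lap_def using int sub
      by (intro integral_subset_le) (auto intro: integrable_on_subinterval simp: \<phi>_def)
    finally show ?thesis by (simp add: mult_exp_exp add.commute mult.assoc)
  qed
  then show thesis using that[of "c0 * exp (- K)" K] c0 K by (simp add: \<kappa>_def)
qed

end

subsection \<open>Dual functions at one point\<close>

context flat_bump
begin

text \<open>The shift by l is split. Its imaginary part goes into the multiplier R(w - iy), where
  subadditivity of the power costs exp(A y^\<kappa>). Its real part is a modulation of modulus one
  on the time side and costs nothing, so the bound depends on Im l alone.\<close>

lemma shifted_transform:
  assumes R: "R holomorphic_on UNIV" and B: "B \<ge> 0"
    and bound: "\<And>v. norm (R v) \<le> B * exp (A * norm v powr (\<rho> / (1 + \<rho>)))" and A: "A \<ge> 0"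
    and small: "exp A * (2 * (2 * a * \<rho> / 9) powr (- 1 / \<rho>)) \<le> 1 / 2"
    and l: "Im l > 0"
  obtains h where "continuous_on {0..T} h"
    "\<And>t. norm (h t) \<le> 2 * B * exp A * exp (A * Im l powr (\<rho> / (1 + \<rho>)))"
    "\<And>z. integral {0..T} (\<lambda>t. h t * exp (\<i> * z * of_real t)) = R (z - l) * M (z - of_real (Re l))"
    "\<And>z. integral {0..T} (\<lambda>t. of_real t * h t * exp (\<i> * z * of_real t)) =
        - \<i> * deriv R (z - l) * M (z - of_real (Re l)) + R (z - l) * M1 (z - of_real (Re l))"
proof -
  define \<kappa> where "\<kappa> = \<rho> / (1 + \<rho>)"
  have \<kappa>: "0 < \<kappa>" "\<kappa> \<le> 1" using \<rho> by (auto simp: \<kappa>_def)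
  define y where "y = Im l"
  define S where "S = (\<lambda>w. R (w - \<i> * of_real y))"
  have S: "S holomorphic_on UNIV"
    unfolding S_def by (rule holomorphic_on_compose_gen[OF _ R, unfolded o_def]) (auto intro!: holomorphic_intros)
  have S_le: "norm (S w) \<le> B * exp (A * y powr \<kappa>) * exp (A * norm w powr \<kappa>)" for w
  proof -
    have "norm (w - \<i> * of_real y) \<le> norm w + y"
      using norm_triangle_ineq4[of w "\<i> * of_real y"] l by (simp add: y_def norm_mult)
    then have "norm (w - \<i> * of_real y) powr \<kappa> \<le> (norm w + y) powr \<kappa>"
      using \<kappa> by (intro powr_mono2) auto
    also have "\<dots> \<le> norm w powr \<kappa> + y powr \<kappa>"
      using \<kappa> l by (intro powr_add_le) (auto simp: y_def)
    finally have "A * norm (w - \<i> * of_real y) powr \<kappa> \<le> A * (norm w powr \<kappa> + y powr \<kappa>)"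
      using A by (intro mult_left_mono)
    then have "B * exp (A * norm (w - \<i> * of_real y) powr \<kappa>) \<le> B * exp (A * (norm w powr \<kappa> + y powr \<kappa>))"
      using B by (intro mult_left_mono) auto
    also have "\<dots> = B * exp (A * y powr \<kappa>) * exp (A * norm w powr \<kappa>)"
      by (simp add: distrib_left exp_add)
    finally show ?thesis
      using bound[of "w - \<i> * of_real y"] by (simp add: S_def flip: \<kappa>_def)
  qed
  obtain h0 where h0: "continuous_on {0..T} h0" "\<And>t. norm (h0 t) \<le> 2 * (B * exp (A * y powr \<kappa>)) * exp A"
    "\<And>w. integral {0..T} (\<lambda>t. h0 t * exp (\<i> * w * of_real t)) = S w * M w"
    using multiplier_transform[OF S _ S_le[unfolded \<kappa>_def] small] B by (auto simp flip: \<kappa>_def)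
  define h where "h = (\<lambda>t. h0 t * exp (\<i> * of_real (- Re l * t)))"
  have conth: "continuous_on {0..T} h" unfolding h_def by (intro continuous_intros h0)
  have F: "integral {0..T} (\<lambda>t. h t * exp (\<i> * z * of_real t)) = R (z - l) * M (z - of_real (Re l))" for z
  proof -
    have "h t * exp (\<i> * z * of_real t) = h0 t * exp (\<i> * (z - of_real (Re l)) * of_real t)" for t
    proof -
      have "\<i> * of_real (- Re l * t) + \<i> * z * of_real t = \<i> * (z - of_real (Re l)) * of_real t"
        by (simp add: algebra_simps)
      then show ?thesis by (simp only: h_def mult.assoc exp_add[symmetric])
    qed
    then have "integral {0..T} (\<lambda>t. h t * exp (\<i> * z * of_real t)) = S (z - of_real (Re l)) * M (z - of_real (Re l))"
      using h0(3) by simp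
    also have "z - of_real (Re l) - \<i> * of_real y = z - l"
      by (simp add: y_def complex_eq_iff)
    then have "S (z - of_real (Re l)) = R (z - l)" by (simp only: S_def)
    finally show ?thesis .
  qed
  have F': "integral {0..T} (\<lambda>t. of_real t * h t * exp (\<i> * z * of_real t)) =
        - \<i> * deriv R (z - l) * M (z - of_real (Re l)) + R (z - l) * M1 (z - of_real (Re l))" for z
  proof -
    let ?G = "integral {0..T} (\<lambda>t. of_real t * h t * exp (\<i> * z * of_real t))"
    have dF: "((\<lambda>z. R (z - l) * M (z - of_real (Re l))) has_field_derivative \<i> * ?G) (at z)"
      using has_field_derivative_integral_exp[OF conth] unfolding F .
    have shift: "((\<lambda>z. z - c) has_field_derivative 1) (at z)" for c
      by (auto intro!: derivative_eq_intros)
    have dR: "((\<lambda>z. R (z - l)) has_field_derivative deriv R (z - l)) (at z)"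
      using DERIV_chain2[OF holomorphic_derivI[OF R open_UNIV UNIV_I] shift[of l]] by simp
    have dM: "((\<lambda>z. M (z - of_real (Re l))) has_field_derivative \<i> * M1 (z - of_real (Re l))) (at z)"
      using DERIV_chain2[OF M_has_field_derivative shift[of "of_real (Re l)"]] by simp
    have "\<i> * ?G = deriv R (z - l) * M (z - of_real (Re l)) + R (z - l) * (\<i> * M1 (z - of_real (Re l)))"
      using DERIV_unique[OF dF DERIV_mult[OF dR dM]] by (simp add: mult.commute add.commute)
    then have "- \<i> * (\<i> * ?G) = - \<i> * (deriv R (z - l) * M (z - of_real (Re l)) + R (z - l) * (\<i> * M1 (z - of_real (Re l))))"
      by simp
    then show ?thesis by (simp add: algebra_simps)
  qed
  have "norm (h t) = norm (h0 t)" for t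
    unfolding h_def norm_mult norm_exp_i_times by simp
  then have "norm (h t) \<le> 2 * B * exp A * exp (A * Im l powr (\<rho> / (1 + \<rho>)))" for t
    using h0(2)[of t] by (simp add: y_def \<kappa>_def mult_ac)
  then show thesis by (rule that[OF conth _ F F'])
qed

text \<open>Orders 0 and 1 are the complex conjugates of the pairings of \<open>cnj h\<close> with
  e^(izt) and t e^(izt).\<close>

definition moment :: "nat \<Rightarrow> (real \<Rightarrow> complex) \<Rightarrow> complex \<Rightarrow> complex" where
  "moment j h z = integral {0..T} (\<lambda>t. of_real t ^ j * h t * exp (\<i> * z * of_real t))"

text \<open>The transforms of \<open>h1\<close> and \<open>h2\<close> are \<open>Q (z - l) * (1 + \<beta> * (z - l)) * M (z - Re l) / M (\<i> * Im l)\<close> and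
  \<open>\<i> * (z - l) * Q (z - l) * M (z - Re l) / M (\<i> * Im l)\<close>, where \<open>\<beta>\<close> cancels the derivative at \<open>l\<close>.\<close>
lemma dual_pair:
  assumes A: "A \<ge> 0" and small: "exp (A + 1) * (2 * (2 * a * \<rho> / 9) powr (- 1 / \<rho>)) \<le> 1 / 2"
  obtains K K' where "K > 0" "K' > 0"
    "\<And>Q l. \<lbrakk>Q holomorphic_on UNIV; Q 0 = 1; \<And>v. norm (Q v) \<le> exp (A * norm v powr (\<rho> / (1 + \<rho>))); Im l > 0\<rbrakk>
      \<Longrightarrow> \<exists>h1 h2. continuous_on {0..T} h1 \<and> continuous_on {0..T} h2 \<and>
           (\<forall>t. norm (h1 t) \<le> K * exp (K' * Im l powr (\<rho> / (1 + \<rho>)))) \<and>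
           (\<forall>t. norm (h2 t) \<le> K * exp (K' * Im l powr (\<rho> / (1 + \<rho>)))) \<and>
           moment 0 h1 l = 1 \<and> moment 1 h1 l = 0 \<and> moment 0 h2 l = 0 \<and> moment 1 h2 l = 1 \<and>
           (\<forall>z. Q (z - l) = 0 \<and> deriv Q (z - l) = 0 \<longrightarrow>
              moment 0 h1 z = 0 \<and> moment 1 h1 z = 0 \<and> moment 0 h2 z = 0 \<and> moment 1 h2 z = 0)"
proof -
  define \<kappa> where "\<kappa> = \<rho> / (1 + \<rho>)"
  have \<kappa>: "0 < \<kappa>" "\<kappa> \<le> 1" using \<rho> by (auto simp: \<kappa>_def)
  obtain c C where cC: "c > 0" "C > 0" "\<And>y. y > 0 \<Longrightarrow> c * exp (- (C * y powr \<kappa>)) \<le> lap y"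
    unfolding \<kappa>_def using lap_lower_bound by blast
  \<comment> \<open>The constant of \<open>power_le_exp_powr\<close> for k = 1 and \<alpha> = 1: a
    linear factor is absorbed by raising A to A + 1.\<close>
  define X where "X = (2 / \<kappa>) powr (1 / \<kappa>)"
  have X: "x \<le> X * exp (x powr \<kappa>)" if "x \<ge> 0" for x
    using power_le_exp_powr[of x 1 \<kappa> 1] \<kappa> that by (cases "x = 0") (auto simp: X_def)
  have X0: "X \<ge> 0" by (simp add: X_def)
  \<comment> \<open>Bounds the factor \<alpha> + \<beta>v for |\<alpha>| \<le> 1 and |\<beta>| \<le>
    exp A + T + 1, which covers both dual functions.\<close>
  define L where "L = 1 + (exp A + T + 1) * X"
  have L: "L > 0" using X0 T by (auto simp: L_def intro!: add_pos_nonneg mult_nonneg_nonneg add_nonneg_nonneg)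
  define K where "K = 2 * (L / c) * exp (A + 1)"
  \<comment> \<open>A + 1 comes from recentring the multiplier at l, C from dividing by
    \<open>lap y\<close>.\<close>
  define K' where "K' = A + 1 + C"
  have "\<exists>h1 h2. continuous_on {0..T} h1 \<and> continuous_on {0..T} h2 \<and>
           (\<forall>t. norm (h1 t) \<le> K * exp (K' * Im l powr \<kappa>)) \<and>
           (\<forall>t. norm (h2 t) \<le> K * exp (K' * Im l powr \<kappa>)) \<and>
           moment 0 h1 l = 1 \<and> moment 1 h1 l = 0 \<and> moment 0 h2 l = 0 \<and> moment 1 h2 l = 1 \<and>
           (\<forall>z. Q (z - l) = 0 \<and> deriv Q (z - l) = 0 \<longrightarrow>
              moment 0 h1 z = 0 \<and> moment 1 h1 z = 0 \<and> moment 0 h2 z = 0 \<and> moment 1 h2 z = 0)"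
    if Q: "Q holomorphic_on UNIV" "Q 0 = 1" "\<And>v. norm (Q v) \<le> exp (A * norm v powr \<kappa>)" and l: "Im l > 0" for Q l
  proof -
    define y where "y = Im l"
    have y: "y > 0" using l by (simp add: y_def)
    have l_eq: "l - of_real (Re l) = \<i> * of_real y" by (simp add: y_def complex_eq_iff)
    have "lap y \<ge> c * exp (- (C * y powr \<kappa>))" using cC(3)[OF y] .
    moreover have "c * exp (- (C * y powr \<kappa>)) > 0" using cC by simp
    ultimately have lap_pos: "lap y > 0" and lap_ge: "c * exp (- (C * y powr \<kappa>)) \<le> lap y" by linarith+
    \<comment> \<open>Since Q(0) = 1, q and ir are the logarithmic derivatives at l of Q(z - l) and
      M(z - Re l); hence \<beta> = -q - ir makes the derivative of the first transform vanish at
      l.\<close>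
    define q where "q = deriv Q 0"
    have "norm ((deriv ^^ 1) Q 0) \<le> fact 1 * exp A / 1 ^ 1"
    proof (rule Cauchy_inequality)
      show "Q holomorphic_on ball 0 1" using Q(1) by (rule holomorphic_on_subset) auto
      show "continuous_on (cball 0 1) Q"
        using Q(1) by (meson continuous_on_subset holomorphic_on_imp_continuous_on subset_UNIV)
      show "norm (Q x) \<le> exp A" if "norm (0 - x) = 1" for x using Q(3)[of x] that by simp
    qed auto
    then have q: "norm q \<le> exp A" by (simp add: q_def)
    define r where "r = M1 (\<i> * of_real y) / of_real (lap y)"
    have r: "norm r \<le> T"
      using norm_M1_imaginary_le[of y] lap_pos by (simp add: r_def norm_divide field_simps)
    have Qd: "(Q has_field_derivative deriv Q v) (at v)" for v
      using Q(1) by (simp add: holomorphic_derivI)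
    have pair: "\<exists>h. continuous_on {0..T} h \<and> (\<forall>t. norm (h t) \<le> K * exp (K' * y powr \<kappa>)) \<and>
        (\<forall>z. moment 0 h z = Q (z - l) * (\<alpha> + \<beta> * (z - l)) / of_real (lap y) * M (z - of_real (Re l))) \<and>
        (\<forall>z. moment 1 h z =
          - \<i> * ((deriv Q (z - l) * (\<alpha> + \<beta> * (z - l)) + Q (z - l) * \<beta>) / of_real (lap y)) * M (z - of_real (Re l)) +
          Q (z - l) * (\<alpha> + \<beta> * (z - l)) / of_real (lap y) * M1 (z - of_real (Re l)))"
      if \<alpha>: "norm \<alpha> \<le> 1" and \<beta>: "norm \<beta> \<le> exp A + T + 1" for \<alpha> \<beta>
    proof -
      define R where "R = (\<lambda>v. Q v * (\<alpha> + \<beta> * v) / of_real (lap y))"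
      have R: "R holomorphic_on UNIV"
        unfolding R_def using lap_pos by (intro holomorphic_intros Q) auto
      have R_le: "norm (R v) \<le> L / lap y * exp ((A + 1) * norm v powr \<kappa>)" for v
      proof -
        have e: "1 \<le> exp (norm v powr \<kappa>)" by simp
        have "norm (\<alpha> + \<beta> * v) \<le> norm \<alpha> + norm \<beta> * norm v"
          by (metis norm_mult norm_triangle_ineq)
        also have "\<dots> \<le> 1 * exp (norm v powr \<kappa>) + (exp A + T + 1) * (X * exp (norm v powr \<kappa>))"
          using \<alpha> \<beta> X[of "norm v"] T order.trans[OF \<alpha> e] by (intro add_mono mult_mono) (auto intro: add_nonneg_nonneg)
        also have "\<dots> = L * exp (norm v powr \<kappa>)" by (simp add: L_def algebra_simps)
        finally have "norm (Q v) * norm (\<alpha> + \<beta> * v) \<le> exp (A * norm v powr \<kappa>) * (L * exp (norm v powr \<kappa>))"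
          using Q(3)[of v] by (intro mult_mono) auto
        also have "\<dots> = L * exp ((A + 1) * norm v powr \<kappa>)"
          by (simp add: distrib_right exp_add)
        finally show ?thesis using lap_pos by (simp add: R_def norm_mult norm_divide divide_right_mono)
      qed
      obtain h where h: "continuous_on {0..T} h"
        "\<And>t. norm (h t) \<le> 2 * (L / lap y) * exp (A + 1) * exp ((A + 1) * Im l powr \<kappa>)"
        "\<And>z. integral {0..T} (\<lambda>t. h t * exp (\<i> * z * of_real t)) = R (z - l) * M (z - of_real (Re l))"
        "\<And>z. integral {0..T} (\<lambda>t. of_real t * h t * exp (\<i> * z * of_real t)) =
            - \<i> * deriv R (z - l) * M (z - of_real (Re l)) + R (z - l) * M1 (z - of_real (Re l))"
      proof (rule shifted_transform[OF R _ R_le[unfolded \<kappa>_def] _ small l, folded \<kappa>_def])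
        show "L / lap y \<ge> 0" "A + 1 \<ge> 0" using L lap_pos A by auto
      qed blast
      have "deriv R v = (deriv Q v * (\<alpha> + \<beta> * v) + Q v * \<beta>) / of_real (lap y)" for v
        unfolding R_def using lap_pos by (intro DERIV_imp_deriv) (auto intro!: derivative_eq_intros Qd)
      moreover have "norm (h t) \<le> K * exp (K' * y powr \<kappa>)" for t
      proof -
        have "L / lap y \<le> L / (c * exp (- (C * y powr \<kappa>)))"
          using lap_ge L cC lap_pos by (intro divide_left_mono) auto
        also have "\<dots> = L / c * exp (C * y powr \<kappa>)" by (simp add: exp_minus field_simps)
        finally have "2 * (L / lap y) * exp (A + 1) * exp ((A + 1) * y powr \<kappa>)
            \<le> 2 * (L / c * exp (C * y powr \<kappa>)) * exp (A + 1) * exp ((A + 1) * y powr \<kappa>)"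
          by (intro mult_right_mono mult_left_mono) auto
        also have "\<dots> = K * exp (K' * y powr \<kappa>)"
        proof -
          have "exp (C * y powr \<kappa>) * exp ((A + 1) * y powr \<kappa>) = exp (K' * y powr \<kappa>)"
            by (simp add: K'_def algebra_simps mult_exp_exp)
          then show ?thesis by (simp add: K_def)
        qed
        finally show ?thesis using h(2)[of t] by (simp add: y_def)
      qed
      ultimately show ?thesis using h by (intro exI[of _ h]) (simp add: moment_def R_def)
    qed
    have "norm (- q - \<i> * r) \<le> exp A + T + 1"
      using norm_triangle_ineq4[of "- q" "\<i> * r"] q r by (simp add: norm_mult)
    from pair[of 1, OF _ this] obtain h1 where h1: "continuous_on {0..T} h1"
      "\<And>t. norm (h1 t) \<le> K * exp (K' * y powr \<kappa>)"
      "\<And>z. moment 0 h1 z = Q (z - l) * (1 + (- q - \<i> * r) * (z - l)) / of_real (lap y) * M (z - of_real (Re l))"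
      "\<And>z. moment 1 h1 z =
          - \<i> * ((deriv Q (z - l) * (1 + (- q - \<i> * r) * (z - l)) + Q (z - l) * (- q - \<i> * r)) / of_real (lap y)) * M (z - of_real (Re l)) +
          Q (z - l) * (1 + (- q - \<i> * r) * (z - l)) / of_real (lap y) * M1 (z - of_real (Re l))"
      by force
    \<comment> \<open>With \<alpha> = 0 the transform vanishes at l, and \<beta> = i cancels the
      factor -i in the first moment, leaving 1.\<close>
    have "norm \<i> \<le> exp A + T + 1" using T by (simp add: add_nonneg_nonneg)
    from pair[of 0, OF _ this] obtain h2 where h2: "continuous_on {0..T} h2"
      "\<And>t. norm (h2 t) \<le> K * exp (K' * y powr \<kappa>)"
      "\<And>z. moment 0 h2 z = Q (z - l) * (0 + \<i> * (z - l)) / of_real (lap y) * M (z - of_real (Re l))"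
      "\<And>z. moment 1 h2 z =
          - \<i> * ((deriv Q (z - l) * (0 + \<i> * (z - l)) + Q (z - l) * \<i>) / of_real (lap y)) * M (z - of_real (Re l)) +
          Q (z - l) * (0 + \<i> * (z - l)) / of_real (lap y) * M1 (z - of_real (Re l))"
      by force
    have "moment 1 h1 l = - \<i> * ((q + (- q - \<i> * r)) / of_real (lap y)) * of_real (lap y) + r"
      unfolding h1 l_eq M_imaginary by (simp add: Q(2) q_def r_def)
    then have "moment 1 h1 l = 0" using lap_pos by (simp add: algebra_simps)
    moreover have "moment 0 h1 l = 1" "moment 0 h2 l = 0" "moment 1 h2 l = 1"
      unfolding h1 h2 l_eq M_imaginary using lap_pos by (auto simp: Q(2))
    ultimately show ?thesis using h1 h2
      by (intro exI[of _ h1] exI[of _ h2]) (simp add: y_def)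
  qed
  moreover have "K > 0" "K' > 0" using L cC A by (auto simp: K_def K'_def)
  ultimately show thesis using that unfolding \<kappa>_def by blast
qed

end

text \<open>The value of \<open>a\<close> solves (2a\<rho>/9)^(1/\<rho>) = 4 exp A, which gives
  equality in the required bound.\<close>

lemma exists_flat_bump:
  assumes "0 < \<rho>" "\<rho> \<le> 1" "T > 0"
  obtains a where "flat_bump a \<rho> T" "exp A * (2 * (2 * a * \<rho> / 9) powr (- 1 / \<rho>)) \<le> 1 / 2"
proof -
  define a where "a = 9 / (2 * \<rho>) * (4 * exp A) powr \<rho>"
  have "a > 0" using assms by (simp add: a_def)
  moreover have "2 * a * \<rho> / 9 = (4 * exp A) powr \<rho>" using assms by (simp add: a_def)
  then have "(2 * a * \<rho> / 9) powr (- 1 / \<rho>) = (4 * exp A) powr (-1)"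
    using assms by (simp only: powr_powr) simp
  then have "exp A * (2 * (2 * a * \<rho> / 9) powr (- 1 / \<rho>)) \<le> 1 / 2"
    by (simp add: powr_minus field_simps)
  ultimately show thesis using that assms by (auto simp: flat_bump_def)
qed

subsection \<open>Biorthogonality\<close>

text \<open>The inner product conjugates its second argument. Conjugating h as well turns the
  pairing into the conjugate of a moment, and the prescribed values 0 and 1 are real.\<close>

lemma L2_conj_continuous:
  fixes h :: "real \<Rightarrow> complex"
  assumes h: "continuous_on {0..T} h" and T: "T > 0" and b: "\<And>t. norm (h t) \<le> B" "B \<ge> 0"
  shows "L2_fun T (\<lambda>t. cnj (h t))"
    and "L2_inner T (\<lambda>t. cnj (h t)) (\<lambda>t. of_real t ^ j * exp (\<i> * l * of_real t)) =
      cnj (integral {0..T} (\<lambda>t. of_real t ^ j * h t * exp (\<i> * l * of_real t)))"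
    and "L2_norm T (\<lambda>t. cnj (h t)) \<le> sqrt T * B"
proof -
  have int: "integrable (lebesgue_on {0<..<T}) f \<and> integral\<^sup>L (lebesgue_on {0<..<T}) f = integral {0..T} f"
    if "continuous_on {0..T} f" for f :: "real \<Rightarrow> 'b::euclidean_space"
  proof -
    have "f absolutely_integrable_on {0..T}"
      using that by (rule absolutely_integrable_continuous_real)
    then have "f absolutely_integrable_on {0<..<T}"
      by (rule set_integrable_subset) auto
    then have "integrable (lebesgue_on {0<..<T}) f"
      by (simp add: integrable_restrict_space set_integrable_def)
    moreover from this have "integral\<^sup>L (lebesgue_on {0<..<T}) f = integral {0<..<T} f"
      by (rule lebesgue_integral_eq_integral) simp
    ultimately show ?thesis by (simp add: integral_open_interval_real)
  qed
  have sq: "continuous_on {0..T} (\<lambda>t. (norm (cnj (h t)))\<^sup>2)"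
    using h by (intro continuous_intros) 
  have c: "continuous_on {0..T} (\<lambda>t. cnj (h t))" using h by (intro continuous_intros)
  show "L2_fun T (\<lambda>t. cnj (h t))"
    unfolding L2_fun_def using borel_measurable_integrable[OF conjunct1[OF int[OF c]]] int[OF sq] by blast
  let ?f = "\<lambda>t. of_real t ^ j * h t * exp (\<i> * l * of_real t)"
  have cf: "continuous_on {0..T} ?f" using h by (intro continuous_intros)
  have "cnj (h t) * cnj (of_real t ^ j * exp (\<i> * l * of_real t)) = cnj (?f t)" for t
    by (simp only: complex_cnj_mult mult_ac)
  then have "L2_inner T (\<lambda>t. cnj (h t)) (\<lambda>t. of_real t ^ j * exp (\<i> * l * of_real t)) =
      (LINT t|lebesgue_on {0<..<T}. cnj (?f t))"
    by (simp only: L2_inner_def)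
  also have "\<dots> = cnj (integral {0..T} ?f)" using int[OF continuous_on_cnj[OF cf]] by (simp only: integral_cnj)
  finally show "L2_inner T (\<lambda>t. cnj (h t)) (\<lambda>t. of_real t ^ j * exp (\<i> * l * of_real t)) =
      cnj (integral {0..T} ?f)" .
  have "integral {0..T} (\<lambda>t. (norm (cnj (h t)))\<^sup>2) \<le> integral {0..T} (\<lambda>t. B\<^sup>2)"
    using sq b by (intro integral_le integrable_continuous_real) (auto intro: power_mono)
  also have "\<dots> = T * B\<^sup>2" using T by simp
  finally have "L2_norm T (\<lambda>t. cnj (h t)) \<le> sqrt (T * B\<^sup>2)"
    unfolding L2_norm_def using int[OF sq] by simp
  then show "L2_norm T (\<lambda>t. cnj (h t)) \<le> sqrt T * B"
    using b by (simp add: real_sqrt_mult)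
qed

text \<open>\<open>Q\<close> is the square of the canonical product over the differences from
  \<open>lam m\<close>. The integers are enumerated by \<open>int_decode\<close>; indices outside
  \<open>L - {m}\<close> get \<open>b j = 0\<close>, a trivial factor.\<close>

lemma double_zero_function:
  fixes lam :: "int \<Rightarrow> complex"
  assumes \<kappa>: "0 < \<kappa>" "\<kappa> \<le> 1/2" and C: "C > 0" and inj: "inj_on lam L" and m: "m \<in> L"
    and count: "counting_bound (lam ` L) \<nu>"
    and \<nu>: "\<And>r. r > 0 \<Longrightarrow> \<nu> r \<le> C * r powr \<kappa>"
  obtains Q where "Q holomorphic_on UNIV" "Q 0 = 1"
    "\<And>v. norm (Q v) \<le> exp (4 * pi * C / \<kappa> * norm v powr \<kappa>)"
    "\<And>n. n \<in> L \<Longrightarrow> n \<noteq> m \<Longrightarrow> Q (lam n - lam m) = 0 \<and> deriv Q (lam n - lam m) = 0"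
proof -
  define I where "I = {j. int_decode j \<in> L - {m}}"
  define z where "z = (\<lambda>j. lam (int_decode j) - lam m)"
  define b where "b = (\<lambda>j. if j \<in> I then 1 / z j else 0)"
  have z0: "z j \<noteq> 0" if "j \<in> I" for j
    using that inj m by (auto simp: I_def z_def inj_on_def)
  have injz: "inj_on z I"
  proof (rule inj_onI)
    fix i j assume ij: "i \<in> I" "j \<in> I" "z i = z j"
    then have "lam (int_decode i) = lam (int_decode j)" by (simp add: z_def)
    then have "int_decode i = int_decode j"
      using ij by (intro inj_onD[OF inj]) (auto simp: I_def)
    then show "i = j" by (rule injD[OF inj_int_decode])
  qed
  have count': "real (card {i \<in> F. norm (z i) \<le> norm (z j)}) \<le> (2 * C) * norm (z j) powr \<kappa>"
    if F: "finite F" "F \<subseteq> I" "j \<in> F" for F j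
  proof -
    \<comment> \<open>The counting bound is for open discs while the sorted count includes equality.
      Doubling the radius bridges this and costs 2^\<kappa> \<le> 2, hence the constant 2C.\<close>
    define r where "r = 2 * norm (z j)"
    have r: "r > 0" using z0[of j] F by (auto simp: r_def)
    let ?S = "{u \<in> lam ` L - {lam m}. norm (u - lam m) < r}"
    have S: "finite ?S" "real (card ?S) \<le> \<nu> r"
      using count m r unfolding counting_bound_def by (auto simp: less_imp_le)
    have "card {i \<in> F. norm (z i) \<le> norm (z j)} \<le> card ?S"
    proof (rule card_inj_on_le[OF _ _ S(1)])
      show "inj_on (\<lambda>i. z i + lam m) {i \<in> F. norm (z i) \<le> norm (z j)}"
        using injz F by (auto simp: inj_on_def)
      have "norm (z i) < r" if "norm (z i) \<le> norm (z j)" for i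
        using that r unfolding r_def by linarith
      moreover have "z i + lam m \<in> lam ` L - {lam m}" if "i \<in> I" for i
        using that z0[OF that] by (auto simp: z_def I_def)
      ultimately show "(\<lambda>i. z i + lam m) ` {i \<in> F. norm (z i) \<le> norm (z j)} \<subseteq> ?S"
        using F(2) by fastforce
    qed
    then have "real (card {i \<in> F. norm (z i) \<le> norm (z j)}) \<le> \<nu> r" using S(2) by linarith
    also have "\<dots> \<le> C * r powr \<kappa>" using \<nu> r by simp
    also have "r powr \<kappa> = 2 powr \<kappa> * norm (z j) powr \<kappa>" by (simp add: r_def powr_mult)
    also have "C * (2 powr \<kappa> * norm (z j) powr \<kappa>) \<le> C * (2 powr 1 * norm (z j) powr \<kappa>)"
      using C \<kappa> by (intro mult_left_mono mult_right_mono powr_mono) auto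
    finally show ?thesis by simp
  qed
  have "(\<Prod>j<n. 1 + r * norm (b j)) \<le> exp (2 * pi * C / \<kappa> * r powr \<kappa>)" if r: "r \<ge> 0" for n r
  proof -
    let ?F = "{..<n} \<inter> I"
    have "(\<Prod>j<n. 1 + r * norm (b j)) = (\<Prod>j\<in>?F. 1 + r * norm (b j))"
      by (rule prod.mono_neutral_right) (auto simp: b_def)
    also have "\<dots> = (\<Prod>j\<in>?F. 1 + r / norm (z j))"
      by (rule prod.cong) (auto simp: b_def norm_divide)
    also have "\<dots> \<le> exp (pi * (2 * C) / (2 * \<kappa>) * r powr \<kappa>)"
    proof (rule prod_le_exp_of_counting)
      show "0 < norm (z j) \<and> real (card {i \<in> ?F. norm (z i) \<le> norm (z j)}) \<le> 2 * C * norm (z j) powr \<kappa>"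
        if "j \<in> ?F" for j
        using count'[of ?F j] z0[of j] that by auto
    qed (use \<kappa> C r in auto)
    also have "\<dots> \<le> exp (2 * pi * C / \<kappa> * r powr \<kappa>)"
      using C \<kappa> by (simp add: field_simps)
    finally show ?thesis .
  qed
  then obtain E where E: "E holomorphic_on UNIV" "E 0 = 1"
    "\<And>z. norm (E z) \<le> exp (2 * pi * C / \<kappa> * norm z powr \<kappa>)"
    "\<And>j. b j \<noteq> 0 \<Longrightarrow> E (1 / b j) = 0"
    by (rule entire_product_exists[where b = b]) blast+
  \<comment> \<open>Squaring makes \<open>deriv Q\<close> vanish at the zeros of \<open>E\<close> as
    well, and doubles the exponent in the growth bound.\<close>
  define Q where "Q = (\<lambda>v. (E v)\<^sup>2)"
  show thesis
  proof (rule that[of Q])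
    show "Q holomorphic_on UNIV" unfolding Q_def by (intro holomorphic_intros E)
    show "Q 0 = 1" by (simp add: Q_def E)
    show "norm (Q v) \<le> exp (4 * pi * C / \<kappa> * norm v powr \<kappa>)" for v
    proof -
      have "norm (Q v) \<le> (exp (2 * pi * C / \<kappa> * norm v powr \<kappa>))\<^sup>2"
        unfolding Q_def norm_power by (intro power_mono E) simp
      also have "\<dots> = exp (4 * pi * C / \<kappa> * norm v powr \<kappa>)"
        by (simp only: power2_eq_square exp_add[symmetric]) simp
      finally show ?thesis .
    qed
    show "Q (lam n - lam m) = 0 \<and> deriv Q (lam n - lam m) = 0" if n: "n \<in> L" "n \<noteq> m" for n
    proof -
      define j where "j = int_encode n"
      have j: "j \<in> I" "z j = lam n - lam m" using n by (auto simp: I_def j_def z_def)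
      then have E0: "E (lam n - lam m) = 0" using E(4)[of j] z0[of j] by (simp add: b_def)
      have "(Q has_field_derivative 2 * E v * deriv E v) (at v)" for v
        unfolding Q_def using holomorphic_derivI[OF E(1) open_UNIV UNIV_I]
        by (auto intro!: derivative_eq_intros)
      then have "deriv Q (lam n - lam m) = 2 * E (lam n - lam m) * deriv E (lam n - lam m)"
        by (rule DERIV_imp_deriv)
      then show ?thesis using E0 by (simp add: Q_def)
    qed
  qed
qed

section \<open>Assembly of the biorthogonal family\<close>

theorem proposition1:
  fixes T \<kappa> R\<^sub>0 C\<^sub>0 C\<^sub>1 :: real
  assumes "T > 0"
    and "\<kappa> = 1/2 \<or> (\<exists>\<alpha>::real. 1 < \<alpha> \<and> \<alpha> < 3/2 \<and> \<kappa> = 1 / (2 * \<alpha>))"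
    and "R\<^sub>0 > 0" and "C\<^sub>0 > 0" and "C\<^sub>1 > 0"
  shows "\<exists>C\<^sub>2 C\<^sub>3 :: real. C\<^sub>2 > 0 \<and> C\<^sub>3 > 0 \<and>
    (\<forall>(L :: int set) (lam :: int \<Rightarrow> complex) (\<nu> :: real \<Rightarrow> real).
       inj_on lam L \<longrightarrow>
       (\<forall>m\<in>L. Im (lam m) > 0) \<longrightarrow>
       (\<forall>r\<ge>0. \<nu> r \<ge> 0) \<longrightarrow>
       counting_bound (lam ` L) \<nu> \<longrightarrow>
       (\<forall>r. 0 \<le> r \<and> r < R\<^sub>0 \<longrightarrow> \<nu> r = 0) \<longrightarrow>
       (\<forall>r\<ge>R\<^sub>0. C\<^sub>0 * r powr \<kappa> \<le> \<nu> r \<and> \<nu> r \<le> C\<^sub>1 * r powr \<kappa>) \<longrightarrow>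
       (\<exists>g :: int \<Rightarrow> nat \<Rightarrow> real \<Rightarrow> complex.
          (\<forall>m\<in>L. \<forall>j\<in>{1, 2}. L2_fun T (g m j)) \<and>
          (\<forall>m\<in>L. \<forall>n\<in>L.
             L2_inner T (g m 1) (\<lambda>t. of_real t * exp (\<i> * lam n * of_real t)) = 0 \<and>
             L2_inner T (g m 1) (\<lambda>t. exp (\<i> * lam n * of_real t)) = (if m = n then 1 else 0) \<and>
             L2_inner T (g m 2) (\<lambda>t. of_real t * exp (\<i> * lam n * of_real t)) = (if m = n then 1 else 0) \<and>
             L2_inner T (g m 2) (\<lambda>t. exp (\<i> * lam n * of_real t)) = 0) \<and>
          (\<forall>m\<in>L. \<forall>j\<in>{1, 2}. L2_norm T (g m j) \<le> C\<^sub>2 * exp (C\<^sub>3 * Im (lam m) powr \<kappa>))))"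
proof -
  have \<kappa>: "0 < \<kappa>" "\<kappa> \<le> 1/2" using assms(2) by (auto simp: field_simps)
  \<comment> \<open>The solution of \<rho>/(1 + \<rho>) = \<kappa>; the condition \<rho> \<le> 1 is
    equivalent to \<kappa> \<le> 1/2.\<close>
  define \<rho> where "\<rho> = \<kappa> / (1 - \<kappa>)"
  have \<rho>: "0 < \<rho>" "\<rho> \<le> 1" "\<rho> / (1 + \<rho>) = \<kappa>" using \<kappa> by (auto simp: \<rho>_def divide_simps)
  define A where "A = 4 * pi * C\<^sub>1 / \<kappa>"
  have A: "A \<ge> 0" using \<kappa> assms(5) by (simp add: A_def)
  obtain a where "flat_bump a \<rho> T"
    and small: "exp (A + 1) * (2 * (2 * a * \<rho> / 9) powr (- 1 / \<rho>)) \<le> 1 / 2"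
    using exists_flat_bump[OF \<rho>(1,2) assms(1)] by blast
  then interpret fb: flat_bump a \<rho> T by simp
  obtain K K' where K: "K > 0" "K' > 0"
    and dual: "\<And>Q l. \<lbrakk>Q holomorphic_on UNIV; Q 0 = 1; \<And>v. norm (Q v) \<le> exp (A * norm v powr \<kappa>); Im l > 0\<rbrakk>
      \<Longrightarrow> \<exists>h1 h2. continuous_on {0..T} h1 \<and> continuous_on {0..T} h2 \<and>
           (\<forall>t. norm (h1 t) \<le> K * exp (K' * Im l powr \<kappa>)) \<and>
           (\<forall>t. norm (h2 t) \<le> K * exp (K' * Im l powr \<kappa>)) \<and>
           fb.moment 0 h1 l = 1 \<and> fb.moment 1 h1 l = 0 \<and> fb.moment 0 h2 l = 0 \<and> fb.moment 1 h2 l = 1 \<and>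
           (\<forall>z. Q (z - l) = 0 \<and> deriv Q (z - l) = 0 \<longrightarrow>
              fb.moment 0 h1 z = 0 \<and> fb.moment 1 h1 z = 0 \<and> fb.moment 0 h2 z = 0 \<and> fb.moment 1 h2 z = 0)"
  proof (rule fb.dual_pair[OF A small, unfolded \<rho>(3)], goal_cases)
    case (1 K K')
    show thesis by (rule that) (fact 1)+
  qed
  show ?thesis
  \<comment> \<open>Both constants are fixed before \<open>L\<close>, \<open>lam\<close> and
    \<open>\<nu>\<close>, hence uniform in them. The factor \<open>sqrt T\<close> passes from a
    pointwise bound on (0, T) to the norm.\<close>
  proof (rule exI[of _ "sqrt T * K"], rule exI[of _ K'], intro conjI allI impI)
    show "sqrt T * K > 0" using assms(1) K by simp
    show "K' > 0" by (rule K)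
    fix L :: "int set" and lam :: "int \<Rightarrow> complex" and \<nu> :: "real \<Rightarrow> real"
    assume inj: "inj_on lam L" and Im: "\<forall>m\<in>L. Im (lam m) > 0" and "\<forall>r\<ge>0. \<nu> r \<ge> 0"
      and count: "counting_bound (lam ` L) \<nu>"
      and \<nu>0: "\<forall>r. 0 \<le> r \<and> r < R\<^sub>0 \<longrightarrow> \<nu> r = 0"
      and \<nu>1: "\<forall>r\<ge>R\<^sub>0. C\<^sub>0 * r powr \<kappa> \<le> \<nu> r \<and> \<nu> r \<le> C\<^sub>1 * r powr \<kappa>"
    \<comment> \<open>Below \<open>R\<^sub>0\<close> the count is zero, so the power bound holds at
      every positive radius.\<close>
    have \<nu>: "\<nu> r \<le> C\<^sub>1 * r powr \<kappa>" if "r > 0" for r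
      using \<nu>0 \<nu>1 that assms(5) by (cases "r < R\<^sub>0") auto
    define good where "good = (\<lambda>m h1 h2. continuous_on {0..T} h1 \<and> continuous_on {0..T} h2 \<and>
      (\<forall>t. norm (h1 t) \<le> K * exp (K' * Im (lam m) powr \<kappa>)) \<and>
      (\<forall>t. norm (h2 t) \<le> K * exp (K' * Im (lam m) powr \<kappa>)) \<and>
      (\<forall>n\<in>L. fb.moment 0 h1 (lam n) = (if m = n then 1 else 0) \<and> fb.moment 1 h1 (lam n) = 0 \<and>
         fb.moment 0 h2 (lam n) = 0 \<and> fb.moment 1 h2 (lam n) = (if m = n then 1 else 0)))"
    have "\<exists>h1 h2. good m h1 h2" if m: "m \<in> L" for m
    proof -
      obtain Q where Q: "Q holomorphic_on UNIV" "Q 0 = 1"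
        "\<And>v. norm (Q v) \<le> exp (A * norm v powr \<kappa>)"
        "\<And>n. n \<in> L \<Longrightarrow> n \<noteq> m \<Longrightarrow> Q (lam n - lam m) = 0 \<and> deriv Q (lam n - lam m) = 0"
        unfolding A_def using double_zero_function[OF \<kappa> assms(5) inj m count \<nu>] by blast
      have "Im (lam m) > 0" using Im m by blast
      from dual[OF Q(1-3) this] obtain h1 h2 where h12:
        "continuous_on {0..T} h1 \<and> continuous_on {0..T} h2 \<and>
         (\<forall>t. norm (h1 t) \<le> K * exp (K' * Im (lam m) powr \<kappa>)) \<and>
         (\<forall>t. norm (h2 t) \<le> K * exp (K' * Im (lam m) powr \<kappa>)) \<and>
         fb.moment 0 h1 (lam m) = 1 \<and> fb.moment 1 h1 (lam m) = 0 \<and>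
         fb.moment 0 h2 (lam m) = 0 \<and> fb.moment 1 h2 (lam m) = 1 \<and>
         (\<forall>z. Q (z - lam m) = 0 \<and> deriv Q (z - lam m) = 0 \<longrightarrow>
            fb.moment 0 h1 z = 0 \<and> fb.moment 1 h1 z = 0 \<and> fb.moment 0 h2 z = 0 \<and> fb.moment 1 h2 z = 0)"
        by (elim exE)
      note h = h12[THEN conjunct1] h12[THEN conjunct2, THEN conjunct1]
        h12[THEN conjunct2, THEN conjunct2, THEN conjunct1]
        h12[THEN conjunct2, THEN conjunct2, THEN conjunct2, THEN conjunct1]
      note h' = h12[THEN conjunct2, THEN conjunct2, THEN conjunct2, THEN conjunct2]
      note at_m = h'[THEN conjunct1] h'[THEN conjunct2, THEN conjunct1]
        h'[THEN conjunct2, THEN conjunct2, THEN conjunct1]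
        h'[THEN conjunct2, THEN conjunct2, THEN conjunct2, THEN conjunct1]
      note at_n = h'[THEN conjunct2, THEN conjunct2, THEN conjunct2, THEN conjunct2, rule_format]
      have "good m h1 h2"
        unfolding good_def
      proof (intro conjI ballI h)
        fix n assume "n \<in> L"
        have other: "fb.moment 0 h1 (lam n) = 0 \<and> fb.moment 1 h1 (lam n) = 0 \<and>
            fb.moment 0 h2 (lam n) = 0 \<and> fb.moment 1 h2 (lam n) = 0" if "n \<noteq> m"
          by (rule at_n[OF Q(4)[OF \<open>n \<in> L\<close> that]])
        show "fb.moment 0 h1 (lam n) = (if m = n then 1 else 0)" "fb.moment 1 h1 (lam n) = 0"
          "fb.moment 0 h2 (lam n) = 0" "fb.moment 1 h2 (lam n) = (if m = n then 1 else 0)"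
          using at_m other by (cases "m = n"; simp)+
      qed
      then show ?thesis by blast
    qed
    \<comment> \<open>Choice is applied twice, so that the second function is chosen for the already
      fixed first one.\<close>
    then have "\<exists>H. \<forall>m\<in>L. \<exists>h2. good m (H m) h2" by (intro bchoice) blast
    then obtain H1 where "\<forall>m\<in>L. \<exists>h2. good m (H1 m) h2" ..
    then have "\<exists>H. \<forall>m\<in>L. good m (H1 m) (H m)" by (intro bchoice)
    then obtain H2 where H: "\<And>m. m \<in> L \<Longrightarrow> good m (H1 m) (H2 m)" by blast
    define g where "g = (\<lambda>m j t. cnj (if j = (1::nat) then H1 m t else H2 m t))"
    have g: "g m 1 = (\<lambda>t. cnj (H1 m t))" "g m 2 = (\<lambda>t. cnj (H2 m t))" for m
      by (simp_all add: g_def)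
    define B where "B = (\<lambda>m. K * exp (K' * Im (lam m) powr \<kappa>))"
    have B: "B m \<ge> 0" for m using K by (simp add: B_def)
    have H': "continuous_on {0..T} (H1 m)" "continuous_on {0..T} (H2 m)"
      "\<And>t. norm (H1 m t) \<le> B m" "\<And>t. norm (H2 m t) \<le> B m" if "m \<in> L" for m
      using H[OF that] by (auto simp: good_def B_def)
    show "\<exists>g :: int \<Rightarrow> nat \<Rightarrow> real \<Rightarrow> complex.
          (\<forall>m\<in>L. \<forall>j\<in>{1, 2}. L2_fun T (g m j)) \<and>
          (\<forall>m\<in>L. \<forall>n\<in>L.
             L2_inner T (g m 1) (\<lambda>t. of_real t * exp (\<i> * lam n * of_real t)) = 0 \<and>
             L2_inner T (g m 1) (\<lambda>t. exp (\<i> * lam n * of_real t)) = (if m = n then 1 else 0) \<and>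
             L2_inner T (g m 2) (\<lambda>t. of_real t * exp (\<i> * lam n * of_real t)) = (if m = n then 1 else 0) \<and>
             L2_inner T (g m 2) (\<lambda>t. exp (\<i> * lam n * of_real t)) = 0) \<and>
          (\<forall>m\<in>L. \<forall>j\<in>{1, 2}. L2_norm T (g m j) \<le> sqrt T * K * exp (K' * Im (lam m) powr \<kappa>))"
    proof (intro exI[of _ g] conjI ballI)
      fix m j assume m: "m \<in> L" and j: "j \<in> {1, 2 :: nat}"
      note L2_1 = L2_conj_continuous(1,3)[OF H'(1)[OF m] assms(1) H'(3)[OF m] B]
      note L2_2 = L2_conj_continuous(1,3)[OF H'(2)[OF m] assms(1) H'(4)[OF m] B]
      have "L2_fun T (g m 1)" "L2_fun T (g m 2)" unfolding g by (rule L2_1(1), rule L2_2(1))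
      then show "L2_fun T (g m j)" using j by blast
      have "L2_norm T (g m 1) \<le> sqrt T * B m" "L2_norm T (g m 2) \<le> sqrt T * B m"
        unfolding g by (rule L2_1(2), rule L2_2(2))
      then have "L2_norm T (g m j) \<le> sqrt T * B m" using j by blast
      then show "L2_norm T (g m j) \<le> sqrt T * K * exp (K' * Im (lam m) powr \<kappa>)"
        by (simp only: B_def mult.assoc)
    next
      fix m n assume m: "m \<in> L" and n: "n \<in> L"
      have mom: "fb.moment 0 (H1 m) (lam n) = (if m = n then 1 else 0)" "fb.moment 1 (H1 m) (lam n) = 0"
         "fb.moment 0 (H2 m) (lam n) = 0" "fb.moment 1 (H2 m) (lam n) = (if m = n then 1 else 0)"
        using H[OF m] n by (auto simp: good_def)
      note inner1 = L2_conj_continuous(2)[OF H'(1)[OF m] assms(1) H'(3)[OF m] B, of _ "lam n", folded fb.moment_def g]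
      note inner2 = L2_conj_continuous(2)[OF H'(2)[OF m] assms(1) H'(4)[OF m] B, of _ "lam n", folded fb.moment_def g]
      show "L2_inner T (g m 1) (\<lambda>t. of_real t * exp (\<i> * lam n * of_real t)) = 0"
        using inner1[of 1] mom by simp
      show "L2_inner T (g m 1) (\<lambda>t. exp (\<i> * lam n * of_real t)) = (if m = n then 1 else 0)"
        using inner1[of 0] mom by simp
      show "L2_inner T (g m 2) (\<lambda>t. of_real t * exp (\<i> * lam n * of_real t)) = (if m = n then 1 else 0)"
        using inner2[of 1] mom by simp
      show "L2_inner T (g m 2) (\<lambda>t. exp (\<i> * lam n * of_real t)) = 0"
        using inner2[of 0] mom by simp
    qed
  qed
qed

end
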